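(* Let $(x^k)_k$ be generated by Algorithm S4N (described in the context) and suppose that the following hold: (A.1) $\nabla f$ is Lipschitz continuous on $\mathbb{R}^n$ with modulus $L>0$; (A.2) $\psi$ is bounded from below on $\mathrm{dom}\, r$; (B.1) there are $0<\lambda_m\le\lambda_M<\infty$ with $\lambda_M I\succeq\Lambda_k\succeq\lambda_m I$ for all $k$; (B.2) $(\nu_k)_k,(\varepsilon^2_k)_k\in\ell^1_+$ and $(\varepsilon^1_k)_k\in\ell^p_+$ (with $p$ the algorithm parameter); (C.1) for every $k$, $M_k$ is an $\mathcal F_k$-measurable selection of the multifunction $\omega\mapsto\mathcal M^{\Lambda_k}_{s^k(\omega),t^k(\omega)}(x^k(\omega))$; (C.2) for every $k$ there is $\sigma_k\ge0$ with $\mathbb E[\|\nabla f(x^k)-G_{s^k}(x^k)\|^2]\le\sigma_k^2$. Suppose further that the step sizes $\alpha_k\in[0,1]$ are such that, for some fixed $\gamma\in(0,1)$ and $\rho\in(1,\gamma^{-1})$ and with $v^k:=-F^{\Lambda_k}_{s^k}(x^k)$, $$\psi(x^k+\alpha_k v^k)-\psi(x^k)\le-\alpha_k\gamma\|v^k\|_{\Lambda_k}^2+\frac{\alpha_k}{4\gamma(\rho-1)\lambda_m}\|\nabla f(x^k)-G_{s^k}(x^k)\|^2\quad\text{for all }k,$$ and that $(\alpha_k)_k$ is monotonically decreasing with $\sum_k\alpha_k=\infty$ and $\sum_k\alpha_k\sigma_k^2<\infty$. Then for every $\Lambda\in\mathbb S^n_{++}$ it holds $\liminf_{k\to\infty}\mathbb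 E[\|F^\Lambda(x^k)\|^2]=0$ and $\liminf_{k\to\infty}\|F^\Lambda(x^k)\|=0$ almost surely.
   Context: Setting: $f:\mathbb{R}^n\to\mathbb{R}$ is continuously differentiable, $r:\mathbb{R}^n\to(-\infty,+\infty]$ is convex, lower semicontinuous and proper, and $\psi:=f+r$. $\mathbb S^n$ ($\mathbb S^n_{++}$) denotes symmetric (symmetric positive definite) $n\times n$ matrices. For $\Lambda\in\mathbb S^n_{++}$: $\|x\|_\Lambda:=\sqrt{\langle x,\Lambda x\rangle}$, $\mathrm{prox}^\Lambda_r(x):=\arg\min_y\, r(y)+\tfrac12\|x-y\|_\Lambda^2$, $u^\Lambda(x):=x-\Lambda^{-1}\nabla f(x)$, $F^\Lambda(x):=x-\mathrm{prox}^\Lambda_r(u^\Lambda(x))$. A point $x$ with $F^\Lambda(x)=0$ is called stationary. Stochastic setup: $(\Omega,\mathcal F,\mathbb P)$ is a probability space, $(\Xi,\mathcal X)$ a measurable space, and $\mathcal G:\mathbb{R}^n\times\Xi\to\mathbb{R}^n$, $\mathcal H:\mathbb{R}^n\times\Xi\to\mathbb S^n$ are Carathéodory functions (continuous in $x$, measurable in the second argument). For a mini-batch $s=(s_1,\dots,s_m)$ of measurable maps $s_i:\Omega\to\Xi$ set $G_s(x):=\frac1m\sum_{i=1}^m\mathcal G(x,s_i)$, similarly $H_t(x):=\frac1{m'}\sum_{j=1}^{m'}\mathcal H(x,t_j)$ for $t=(t_1,\dots,t_{m'})$. Put $u^\Lambda_s(x):=x-\Lambda^{-1}G_s(x)$,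 $F^\Lambda_s(x):=x-\mathrm{prox}^\Lambda_r(u^\Lambda_s(x))$, and $\mathcal M^\Lambda_{s,t}(x):=\{(I-D)+D\Lambda^{-1}H_t(x): D\in\partial\mathrm{prox}^\Lambda_r(u^\Lambda_s(x))\}$, where $\partial$ denotes the Clarke generalized Jacobian. Algorithm S4N: given $x^0\in\mathrm{dom}\,r$, $\theta_0\ge0$, deterministic matrices $(\Lambda_k)_k\subset\mathbb S^n_{++}$, step sizes $(\alpha_k)_k$, constants $\eta,p\in(0,1)$, $\beta>0$, nonnegative sequences $(\nu_k),(\varepsilon^1_k),(\varepsilon^2_k)$, sample sizes $\mathbf n^g_k,\mathbf n^h_k$ and mini-batches $s^k=(s^k_1,\dots,s^k_{\mathbf n^g_k})$, $t^k=(t^k_1,\dots,t^k_{\mathbf n^h_k})$ of random samples. At iteration $k$: choose $M_k\in\mathcal M^{\Lambda_k}_{s^k,t^k}(x^k)$, set $d^k:=-M_k^+F^{\Lambda_k}_{s^k}(x^k)$ ($M^+$ the Moore–Penrose inverse; i.e. $d^k$ solves $M_kd^k=-F^{\Lambda_k}_{s^k}(x^k)$), $z^k_{\mathsf n}:=x^k+d^k$ and $z^k_{\mathsf p}:=x^k-\alpha_kF^{\Lambda_k}_{s^k}(x^k)$. If $z^k_{\mathsf n}\in\mathrm{dom}\,r$ and both (G1) $\|F^{\Lambda_{k+1}}_{s^{k+1}}(z^k_{\mathsf n})\|\le(\eta+\nu_k)\theta_k+\varepsilon^1_k$ and (G2) $\psi(z^k_{\mathsf n})\le\psi(x^k)+\beta\theta_k^{1-p}\|F^{\Lambda_{k+1}}_{s^{k+1}}(z^k_{\mathsf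 n})\|^p+\varepsilon^2_k$ hold, set $x^{k+1}:=z^k_{\mathsf n}$, $\theta_{k+1}:=\|F^{\Lambda_{k+1}}_{s^{k+1}}(z^k_{\mathsf n})\|$; otherwise set $x^{k+1}:=z^k_{\mathsf p}$, $\theta_{k+1}:=\theta_k$. Filtrations: $\mathcal F_k:=\sigma(s^0,\dots,s^k,t^0,\dots,t^k)$, $\hat{\mathcal F}_k:=\sigma(s^0,\dots,s^{k+1},t^0,\dots,t^k)$. *)

theory Defs
  imports "HOL-Analysis.Analysis" "HOL-Probability.Probability"
begin

definition edom :: "('a \<Rightarrow> ereal) \<Rightarrow> 'a set" where
  "edom r = {x. r x < \<infinity>}"

definition proper_fun :: "('a \<Rightarrow> ereal) \<Rightarrow> bool" where
  "proper_fun r \<longleftrightarrow> (\<forall>x. r x \<noteq> -\<infinity>) \<and> (\<exists>x. r x < \<infinity>)"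

definition convex_efun :: "('a::real_vector \<Rightarrow> ereal) \<Rightarrow> bool" where
  "convex_efun r \<longleftrightarrow> (\<forall>x y t. 0 \<le> t \<and> t \<le> 1 \<longrightarrow>
      r ((1 - t) *\<^sub>R x + t *\<^sub>R y) \<le> ereal (1 - t) * r x + ereal t * r y)"

definition lsc_efun :: "('a::topological_space \<Rightarrow> ereal) \<Rightarrow> bool" where
  "lsc_efun r \<longleftrightarrow> (\<forall>x. r x \<le> Liminf (at x) r)"

definition sym_mat :: "real^'n^'n \<Rightarrow> bool" where
  "sym_mat A \<longleftrightarrow> transpose A = A"

definition pos_def :: "real^'n^'n \<Rightarrow> bool" where
  "pos_def A \<longleftrightarrow> sym_mat A \<and> (\<forall>v. v \<noteq> 0 \<longrightarrow> v \<bullet> (A *v v) > 0)"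

definition loewner_le :: "real^'n^'n \<Rightarrow> real^'n^'n \<Rightarrow> bool" where
  "loewner_le A B \<longleftrightarrow> (\<forall>v. v \<bullet> (A *v v) \<le> v \<bullet> (B *v v))"

definition pinv :: "real^'n^'n \<Rightarrow> real^'n^'n" where
  "pinv A = (THE X. A ** X ** A = A \<and> X ** A ** X = X \<and>
                    transpose (A ** X) = A ** X \<and> transpose (X ** A) = X ** A)"

definition mnorm :: "real^'n^'n \<Rightarrow> real^'n \<Rightarrow> real" where
  "mnorm L x = sqrt (x \<bullet> (L *v x))"

definition clarke_jac :: "(real^'n \<Rightarrow> real^'n) \<Rightarrow> real^'n \<Rightarrow> (real^'n^'n) set" where
  "clarke_jac F x = convex hull
     {A. \<exists>y J. y \<longlonglongrightarrow> x \<and> J \<longlonglongrightarrow> A \<and>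
               (\<forall>k. (F has_derivative (\<lambda>h. J k *v h)) (at (y k)))}"

definition prox :: "real^'n^'n \<Rightarrow> (real^'n \<Rightarrow> ereal) \<Rightarrow> real^'n \<Rightarrow> real^'n" where
  "prox L r x = arg_min (\<lambda>y. r y + ereal ((mnorm L (x - y))\<^sup>2 / 2)) (\<lambda>_. True)"

text \<open>\<open>u^\<Lambda>(x) = x - \<Lambda>^{-1} g(x)\<close> where \<open>g\<close> is the (possibly stochastic) gradient.\<close>
definition uL :: "real^'n^'n \<Rightarrow> (real^'n \<Rightarrow> real^'n) \<Rightarrow> real^'n \<Rightarrow> real^'n" where
  "uL L g x = x - matrix_inv L *v g x"

definition FL :: "real^'n^'n \<Rightarrow> (real^'n \<Rightarrow> ereal) \<Rightarrow> (real^'n \<Rightarrow> real^'n) \<Rightarrow> real^'n \<Rightarrow> real^'n" where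
  "FL L r g x = x - prox L r (uL L g x)"

definition Gbatch :: "(real^'n \<Rightarrow> 'xi \<Rightarrow> real^'n) \<Rightarrow> nat \<Rightarrow> (nat \<Rightarrow> 'w \<Rightarrow> 'xi) \<Rightarrow> 'w \<Rightarrow> real^'n \<Rightarrow> real^'n" where
  "Gbatch \<G> m s \<omega> x = (1 / real m) *\<^sub>R (\<Sum>i<m. \<G> x (s i \<omega>))"

definition Hbatch :: "(real^'n \<Rightarrow> 'xi \<Rightarrow> real^'n^'n) \<Rightarrow> nat \<Rightarrow> (nat \<Rightarrow> 'w \<Rightarrow> 'xi) \<Rightarrow> 'w \<Rightarrow> real^'n \<Rightarrow> real^'n^'n" where
  "Hbatch \<H> m t \<omega> x = (1 / real m) *\<^sub>R (\<Sum>j<m. \<H> x (t j \<omega>))"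

definition Mset :: "real^'n^'n \<Rightarrow> (real^'n \<Rightarrow> ereal) \<Rightarrow> (real^'n \<Rightarrow> real^'n) \<Rightarrow> (real^'n \<Rightarrow> real^'n^'n)
                      \<Rightarrow> real^'n \<Rightarrow> (real^'n^'n) set" where
  "Mset L r G H x = {(mat 1 - D) + D ** matrix_inv L ** H x | D. D \<in> clarke_jac (prox L r) (uL L G x)}"

definition filt :: "'w measure \<Rightarrow> 'xi measure \<Rightarrow> (nat \<Rightarrow> nat \<Rightarrow> 'w \<Rightarrow> 'xi) \<Rightarrow> (nat \<Rightarrow> nat)
                     \<Rightarrow> (nat \<Rightarrow> nat \<Rightarrow> 'w \<Rightarrow> 'xi) \<Rightarrow> (nat \<Rightarrow> nat) \<Rightarrow> nat \<Rightarrow> 'w measure" where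
  "filt P X s ng t nh k = sigma (space P)
     (\<Union>j\<le>k. (\<Union>i<ng j. {s j i -` A \<inter> space P | A. A \<in> sets X})
            \<union> (\<Union>i<nh j. {t j i -` A \<inter> space P | A. A \<in> sets X}))"

end

theory Submission
  imports Defs
begin

text \<open>Optimality of the proximal point is a variational inequality; adding it for two metrics, points and
  gradients shows that \<open>\<parallel>F\<^sup>\<Lambda>(x')\<parallel>\<close> is at most a constant times \<open>\<parallel>F\<^sub>k\<parallel> + \<parallel>e\<^sub>k\<parallel>\<close>, where \<open>F\<^sub>k\<close> is the
  stochastic residual at \<open>x\<^sub>k\<close>, \<open>e\<^sub>k\<close> the gradient error, and \<open>x'\<close> is either \<open>x\<^sub>k\<close> or the point obtained
  from it by a proximal step.  Proximal steps decrease \<open>\<psi>\<close> by a multiple of \<open>\<alpha>\<^sub>k \<parallel>F\<^sub>k\<parallel>\<^sup>2\<close> up to the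
  error \<open>\<alpha>\<^sub>k \<parallel>e\<^sub>k\<parallel>\<^sup>2\<close>.  Newton steps contract \<open>\<theta>\<close> by a factor close to \<open>\<eta>\<close>, so the sum of \<open>\<theta>\<close> over all Newton
  steps is bounded by a deterministic constant, and so is the total increase of \<open>\<psi>\<close> they cause.
  Estimating the residual at \<open>x\<^sub>k\<^sub>+\<^sub>1\<close> from the step that produced it (here the monotonicity of \<open>\<alpha>\<close> enters),
  one obtains pathwise \<open>\<Sum> \<alpha>\<^sub>k \<parallel>F\<^sup>\<Lambda>(x\<^sub>k)\<parallel>\<^sup>2 \<le> C + C \<Sum> \<alpha>\<^sub>k \<parallel>e\<^sub>k\<parallel>\<^sup>2\<close>, whose right-hand side has finite
  expectation; since \<open>\<Sum> \<alpha>\<^sub>k\<close> diverges, both lower limits vanish.\<close>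

section \<open>Proximal maps in variable metrics\<close>

lemma closed_lsc_sublevel:
  assumes "lsc_efun r" shows "closed {y. r y \<le> c}"
proof -
  have "open {y. c < r y}"
  proof (subst open_subopen, intro ballI)
    fix y assume y: "y \<in> {y. c < r y}"
    then have "c < Liminf (at y) r"
      using assms by (auto simp: lsc_efun_def intro: less_le_trans)
    then have "eventually (\<lambda>z. c < r z) (at y)" by (rule less_LiminfD)
    then show "\<exists>T. open T \<and> y \<in> T \<and> T \<subseteq> {y. c < r y}"
      using y by (auto simp: eventually_at_topological)
  qed
  moreover have "{y. r y \<le> c} = - {y. c < r y}" by auto
  ultimately show ?thesis by (simp add: closed_def)
qed

lemma borel_measurable_lsc:
  assumes "lsc_efun r" shows "r \<in> borel_measurable borel"
proof (rule borel_measurable_iff_Iic_ereal[THEN iffD2], rule allI)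
  fix a
  have "r -` {..a} = {y. r y \<le> a}" by auto
  then show "r -` {..a} \<inter> space borel \<in> sets borel"
    using closed_lsc_sublevel[OF assms, of a] by simp
qed

text \<open>Finite intersection property: for finitely many \<open>z\<close> in \<open>K\<close>, a
  minimizer of \<open>h\<close> among them lies in all the closed sets
  \<open>{y. h y \<le> h z}\<close>, so these sets have a common point in \<open>K\<close>.\<close>

lemma compact_attains_inf_of_closed_sublevels:
  fixes h :: "'a::topological_space \<Rightarrow> ereal"
  assumes K: "compact K" "K \<noteq> {}" and cl: "\<And>c. closed {y. h y \<le> c}"
  obtains y where "y \<in> K" "\<And>z. z \<in> K \<Longrightarrow> h y \<le> h z"
proof -
  have "K \<inter> (\<Inter>z\<in>K. {y. h y \<le> h z}) \<noteq> {}"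
  proof (rule compact_imp_fip_image[OF K(1)])
    fix I' assume I': "finite I'" "I' \<subseteq> K"
    show "K \<inter> (\<Inter>z\<in>I'. {y. h y \<le> h z}) \<noteq> {}"
    proof (cases "I' = {}")
      case False
      define z where "z = arg_min_on h I'"
      have "z \<in> I'" "\<forall>w\<in>I'. h z \<le> h w"
        using arg_min_if_finite[OF I'(1) False, of h] by (auto simp: z_def not_less)
      then show ?thesis using I' by blast
    qed (use K in auto)
  qed (use cl in auto)
  then show thesis using that by auto
qed

text \<open>Let \<open>m\<close> be the minimum of \<open>r\<close> on the unit ball around a domain
  point \<open>w\<close> and \<open>c = r w\<close>. For a distant \<open>y\<close>, convexity on
  the segment from \<open>w\<close> to \<open>y\<close>, evaluated where it crosses the unit sphere,
  limits the decay of \<open>r\<close> to slope \<open>c - m\<close>. The quadratic term of the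
  proximal problem outgrows such linear decay.\<close>

lemma convex_lsc_minorant:
  fixes r :: "'a::euclidean_space \<Rightarrow> ereal"
  assumes "convex_efun r" "lsc_efun r" "proper_fun r"
  obtains a b w where "0 \<le> b" "r w < \<infinity>" "\<And>y. ereal (a - b * norm (y - w)) \<le> r y"
proof -
  obtain w where w: "r w < \<infinity>" using assms(3) by (auto simp: proper_fun_def)
  have ninf: "\<And>y. r y \<noteq> -\<infinity>" using assms(3) by (auto simp: proper_fun_def)
  obtain c where c: "r w = ereal c" using w ninf[of w] by (cases "r w") auto
  obtain v where v: "v \<in> cball w 1" "\<And>z. z \<in> cball w 1 \<Longrightarrow> r v \<le> r z"
    using compact_attains_inf_of_closed_sublevels[of "cball w 1" r] closed_lsc_sublevel[OF assms(2)]
    by auto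
  have "r v \<le> r w" using v by auto
  then obtain m where m: "r v = ereal m" using c ninf[of v] by (cases "r v") auto
  have mc: "m \<le> c" using \<open>r v \<le> r w\<close> c m by simp
  have "ereal (m - (c - m) * norm (y - w)) \<le> r y" for y
  proof (cases "norm (y - w) \<le> 1")
    case True
    then have "y \<in> cball w 1" by (simp add: dist_norm norm_minus_commute)
    then have "ereal m \<le> r y" using v m by auto
    moreover have "m - (c - m) * norm (y - w) \<le> m" using mc by simp
    ultimately show ?thesis by (meson ereal_less_eq(3) order_trans)
  next
    case False
    define t where "t = 1 / norm (y - w)"
    have t: "0 < t" "t \<le> 1" "t * norm (y - w) = 1" using False by (auto simp: t_def divide_simps)
    define z where "z = (1 - t) *\<^sub>R w + t *\<^sub>R y"
    have "z - w = t *\<^sub>R (y - w)" by (simp add: z_def algebra_simps)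
    then have "norm (z - w) = 1" using t by simp
    then have "ereal m \<le> r z" using v(2)[of z] m by (simp add: dist_norm norm_minus_commute)
    also have "\<dots> \<le> ereal (1 - t) * r w + ereal t * r y"
      using assms(1) t unfolding convex_efun_def z_def by auto
    finally have 1: "ereal m \<le> ereal (1 - t) * r w + ereal t * r y" .
    show ?thesis
    proof (cases "r y")
      case (real q)
      then have "m \<le> (1 - t) * c + t * q" using 1 c by simp
      then have "m - c \<le> t * (q - c)" by (simp add: algebra_simps)
      then have "(m - c) * norm (y - w) \<le> t * (q - c) * norm (y - w)" by (rule mult_right_mono) simp
      also have "\<dots> = (q - c) * (t * norm (y - w))" by simp
      finally have "(m - c) * norm (y - w) \<le> q - c" using t by simp
      then have "c - (c - m) * norm (y - w) \<le> q" by (simp add: algebra_simps)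
      then show ?thesis using real mc by simp
    qed (use ninf in auto)
  qed
  then show thesis using that[of "c - m" w m] mc w by auto
qed

text \<open>The constant is the minimum of the quadratic form on the compact unit sphere;
  homogeneity extends the bound.\<close>

lemma pos_def_coercive:
  fixes L :: "real^'n^'n"
  assumes "pos_def L"
  obtains m where "0 < m" "\<And>v. m * (norm v)\<^sup>2 \<le> v \<bullet> (L *v v)"
proof -
  have "sphere (0::real^'n) 1 \<noteq> {}" by simp
  moreover have "continuous_on (sphere 0 1) (\<lambda>v. v \<bullet> (L *v v))"
    by (intro continuous_intros)
  ultimately obtain w where w: "w \<in> sphere 0 1" "\<And>v. v \<in> sphere 0 1 \<Longrightarrow> w \<bullet> (L *v w) \<le> v \<bullet> (L *v v)"
    using continuous_attains_inf[OF compact_sphere] by blast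
  have "w \<noteq> 0" using w by auto
  then have pos: "0 < w \<bullet> (L *v w)" using assms by (auto simp: pos_def_def)
  have "(w \<bullet> (L *v w)) * (norm v)\<^sup>2 \<le> v \<bullet> (L *v v)" for v
  proof (cases "v = 0")
    case False
    define u where "u = (1 / norm v) *\<^sub>R v"
    have v: "v = norm v *\<^sub>R u" using False by (simp add: u_def)
    have "norm u = 1" using False by (simp add: u_def)
    then have "w \<bullet> (L *v w) \<le> u \<bullet> (L *v u)" using w by simp
    then have "(w \<bullet> (L *v w)) * (norm v)\<^sup>2 \<le> (u \<bullet> (L *v u)) * (norm v)\<^sup>2"
      by (rule mult_right_mono) simp
    also have "\<dots> = v \<bullet> (L *v v)"
      by (subst (2 3) v) (simp add: matrix_vector_mult_scaleR power2_eq_square)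
    finally show ?thesis .
  qed simp
  then show thesis using that pos by blast
qed

lemma mnorm_power2:
  assumes "pos_def L" shows "(mnorm L v)\<^sup>2 = v \<bullet> (L *v v)"
proof -
  have "0 \<le> v \<bullet> (L *v v)"
    using assms by (cases "v = 0") (simp_all add: pos_def_def less_imp_le)
  then show ?thesis by (simp add: mnorm_def)
qed

lemma sym_mat_inner:
  assumes "sym_mat L" shows "(L *v v) \<bullet> w = v \<bullet> (L *v w)"
  using assms dot_lmul_matrix[of v L w] transpose_matrix_vector[of L v] by (metis sym_mat_def)

lemma pos_def_inv_cancel:
  fixes L :: "real^'n^'n"
  assumes "pos_def L" shows "L *v (matrix_inv L *v v) = v"
proof -
  have "\<forall>v. L *v v = 0 \<longrightarrow> v = 0" using assms by (force simp: pos_def_def)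
  then have "invertible L"
    using matrix_left_invertible_ker[of L] invertible_left_inverse[of L] by blast
  then have "L ** matrix_inv L = mat 1"
    unfolding invertible_def matrix_inv_def by (rule someI2_ex) simp
  then show ?thesis by (simp add: matrix_vector_mul_assoc)
qed

text \<open>The proximal objective dominates a coercive function, so its sublevel sets are compact.\<close>

lemma prox_is_minimizer:
  fixes L :: "real^'n^'n" and r :: "real^'n \<Rightarrow> ereal"
  assumes r: "convex_efun r" "lsc_efun r" "proper_fun r" and L: "pos_def L"
  shows "r (prox L r u) + ereal ((mnorm L (u - prox L r u))\<^sup>2 / 2) \<le> r z + ereal ((mnorm L (u - z))\<^sup>2 / 2)"
proof -
  define h where "h = (\<lambda>y. r y + ereal ((mnorm L (u - y))\<^sup>2 / 2))"
  obtain a b w where ab: "0 \<le> b" "r w < \<infinity>" "\<And>y. ereal (a - b * norm (y - w)) \<le> r y"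
    by (rule convex_lsc_minorant[OF r]) (rule that)
  obtain m where m: "0 < m" "\<And>v. m * (norm v)\<^sup>2 \<le> v \<bullet> (L *v v)"
    using pos_def_coercive[OF L] by blast
  obtain c where c: "r w = ereal c" using ab r(3) by (cases "r w") (auto simp: proper_fun_def)
  define q where "q = (\<lambda>y. (u - y) \<bullet> (L *v (u - y)) / 2)"
  have hq: "h y = r y + ereal (q y)" for y by (simp add: h_def q_def mnorm_power2[OF L])
  have "continuous_on UNIV (\<lambda>y. L *v (u - y))"
    by (rule linear_continuous_on_compose[OF _ matrix_vector_mul_linear]) (intro continuous_intros)
  then have qc: "continuous_on UNIV q"
    unfolding q_def by (intro continuous_intros) auto
  \<comment> \<open>\<open>C\<close> collects the constants in the comparison of \<open>h w\<close>
    with the minorant at \<open>y\<close>. For \<open>n = norm (y - u) > R\<close> one gets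
    \<open>b + C \<le> m * n / 2\<close>; the summand 1 in \<open>R\<close> ensures
    \<open>n \<ge> 1\<close>, hence \<open>C \<le> C * n\<close>.\<close>
  define C where "C = \<bar>c + q w - a\<bar> + b * norm (u - w)"
  define R where "R = 2 * (b + C) / m + 1"
  have far: "h w \<le> h y" if "R < norm (y - u)" for y
  proof -
    define n where "n = norm (y - u)"
    have C0: "0 \<le> C" using ab by (simp add: C_def)
    have n1: "1 \<le> n" using that ab m C0 by (simp add: n_def R_def) (smt (verit) divide_nonneg_pos)
    have "2 * (b + C) / m \<le> n" using that by (simp add: n_def R_def)
    then have "2 * (b + C) \<le> m * n" using m by (simp add: divide_simps mult.commute)
    then have "b + C \<le> m * n / 2" by simp
    then have "(b + C) * n \<le> (m * n / 2) * n" by (rule mult_right_mono) (use n1 in simp)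
    then have 1: "b * n + C * n \<le> m * n\<^sup>2 / 2" by (simp add: algebra_simps power2_eq_square)
    have 2: "C \<le> C * n" using C0 n1 by (simp add: mult_le_cancel_left1)
    have 3: "m * n\<^sup>2 / 2 \<le> q y" using m(2)[of "u - y"] by (simp add: q_def n_def norm_minus_commute)
    have "norm (y - w) \<le> n + norm (u - w)" unfolding n_def by norm
    then have "b * norm (y - w) \<le> b * n + b * norm (u - w)"
      using mult_left_mono[of _ _ b] ab by (fastforce simp: algebra_simps)
    then have "c + q w \<le> a - b * norm (y - w) + q y" using 1 2 3 unfolding C_def by linarith
    then have "h w \<le> ereal (a - b * norm (y - w)) + ereal (q y)" by (simp add: hq c)
    also have "\<dots> \<le> h y" unfolding hq by (intro add_mono ab) simp
    finally show ?thesis .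
  qed
  \<comment> \<open>Along a convergent sequence the continuous part eventually exceeds
    \<open>q y - e\<close>, so the tail lies in one fixed closed sublevel set of \<open>r\<close>;
    afterwards \<open>e\<close> is arbitrary.\<close>
  have cl: "closed {y. h y \<le> k}" for k
  proof (cases k)
    case (real k')
    have hk: "h y \<le> k \<longleftrightarrow> r y \<le> ereal (k' - q y)" for y
      by (cases "r y") (auto simp: hq real)
    show ?thesis
      unfolding closed_sequential_limits
    proof (intro allI impI, elim conjE)
      fix Y y assume Y: "\<forall>n. Y n \<in> {y. h y \<le> k}" "Y \<longlonglongrightarrow> y"
      have "r y \<le> ereal (k' - q y) + ereal e" if "0 < e" for e
      proof -
        have "(\<lambda>n. q (Y n)) \<longlonglongrightarrow> q y"
          using qc Y(2) by (auto intro: continuous_on_tendsto_compose)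
        then have "eventually (\<lambda>n. q y - e < q (Y n)) sequentially"
          by (rule order_tendstoD) (use that in simp)
        then have "eventually (\<lambda>n. Y n \<in> {z. r z \<le> ereal (k' - q y + e)}) sequentially"
        proof eventually_elim
          case (elim n)
          have "r (Y n) \<le> ereal (k' - q (Y n))" using Y(1) hk by auto
          also have "\<dots> \<le> ereal (k' - q y + e)" using elim by simp
          finally show ?case by simp
        qed
        then have "y \<in> {z. r z \<le> ereal (k' - q y + e)}"
          using Lim_in_closed_set[OF closed_lsc_sublevel[OF r(2)] _ _ Y(2)] by simp
        then show ?thesis by simp
      qed
      then have "r y \<le> ereal (k' - q y)" by (rule ereal_le_epsilon2[rule_format])
      then show "y \<in> {y. h y \<le> k}" by (simp add: hk)
    qed
  next
    case MInf
    have "h y \<noteq> -\<infinity>" for y using r by (auto simp: hq proper_fun_def)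
    then show ?thesis using MInf by simp
  qed simp
  \<comment> \<open>With \<open>w\<close> added to the ball, the minimizer is at most
    \<open>h w\<close>, which bounds \<open>h\<close> from below off the ball.\<close>
  have "compact (insert w (cball u R))" by simp
  then obtain y where y: "\<And>z. z \<in> insert w (cball u R) \<Longrightarrow> h y \<le> h z"
    using compact_attains_inf_of_closed_sublevels[of "insert w (cball u R)" h] cl by blast
  have "h y \<le> h z" for z
  proof (cases "R < norm (z - u)")
    case True
    then show ?thesis using far y[of w] by (meson insertI1 order_trans)
  qed (use y in \<open>auto simp: dist_norm norm_minus_commute\<close>)
  then have "is_arg_min h (\<lambda>_. True) y" by (auto simp: is_arg_min_def not_less)
  then have "is_arg_min h (\<lambda>_. True) (arg_min h (\<lambda>_. True))"
    unfolding arg_min_def by (rule someI)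
  then show ?thesis by (auto simp: is_arg_min_def h_def prox_def not_less)
qed

text \<open>First-order optimality: the proximal point \<open>y\<close> competes with the points of
  the segment from \<open>y\<close> to \<open>z\<close>, and the segment parameter tends to 0. In
  other words, \<open>L *v (u - y)\<close> is a subgradient of \<open>r\<close> at
  \<open>y\<close>.\<close>

lemma prox_variational_inequality:
  fixes L :: "real^'n^'n" and r :: "real^'n \<Rightarrow> ereal"
  assumes r: "convex_efun r" "lsc_efun r" "proper_fun r" and L: "pos_def L"
  shows "prox L r u \<in> edom r"
    and "r (prox L r u) + ereal ((L *v (u - prox L r u)) \<bullet> (z - prox L r u)) \<le> r z"
proof -
  define y where "y = prox L r u"
  have ninf: "\<And>y. r y \<noteq> -\<infinity>" using r(3) by (auto simp: proper_fun_def)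
  have min: "r y + ereal ((u - y) \<bullet> (L *v (u - y)) / 2) \<le> r z + ereal ((u - z) \<bullet> (L *v (u - z)) / 2)" for z
    using prox_is_minimizer[OF r L] by (simp add: y_def mnorm_power2[OF L])
  obtain w where "r w < \<infinity>" using r(3) by (auto simp: proper_fun_def)
  then have ydom: "r y < \<infinity>" using min[of w] ninf[of w]
    by (cases "r w"; cases "r y") auto
  then show "prox L r u \<in> edom r" by (simp add: edom_def y_def)
  obtain c where c: "r y = ereal c" using ydom ninf[of y] by (cases "r y") auto
  have "r y + ereal ((L *v (u - y)) \<bullet> (z - y)) \<le> r z"
  proof (cases "r z")
    case (real d)
    \<comment> \<open>\<open>t * B\<close> is the second-order term that remains after division by
      \<open>t\<close>; it vanishes as \<open>t\<close> decreases to 0.\<close>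
    define B where "B = (z - y) \<bullet> (L *v (z - y)) / 2"
    have ineq: "c + (L *v (u - y)) \<bullet> (z - y) \<le> d + t * B" if t: "0 < t" "t \<le> 1" for t
    proof -
      define v where "v = (1 - t) *\<^sub>R y + t *\<^sub>R z"
      have uv: "u - v = (u - y) - t *\<^sub>R (z - y)" by (simp add: v_def algebra_simps)
      have "r v \<le> ereal (1 - t) * r y + ereal t * r z"
        using r(1) t unfolding convex_efun_def v_def by auto
      then have "r v \<le> ereal ((1 - t) * c + t * d)" by (simp add: c real)
      then have "r y + ereal ((u - y) \<bullet> (L *v (u - y)) / 2)
          \<le> ereal ((1 - t) * c + t * d) + ereal ((u - v) \<bullet> (L *v (u - v)) / 2)"
        using min[of v] by (meson add_right_mono order_trans)
      then have "c + (u - y) \<bullet> (L *v (u - y)) / 2 \<le> (1 - t) * c + t * d + (u - v) \<bullet> (L *v (u - v)) / 2"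
        by (simp add: c)
      then have "t * c + (u - y) \<bullet> (L *v (u - y)) / 2 \<le> t * d + (u - v) \<bullet> (L *v (u - v)) / 2"
        unfolding left_diff_distrib by linarith
      moreover have "(u - v) \<bullet> (L *v (u - v)) = (u - y) \<bullet> (L *v (u - y))
          - 2 * t * ((L *v (u - y)) \<bullet> (z - y)) + t * (t * (2 * B))"
        using sym_mat_inner[of L "u - y" "z - y"] L
        unfolding uv B_def matrix_vector_mult_diff_distrib[of L "u - y" "t *\<^sub>R (z - y)"]
          matrix_vector_mult_scaleR
        by (simp add: pos_def_def inner_diff_left[of "u - y"] inner_diff_right[of _ "L *v (u - y)"]
            inner_commute[of "z - y" "L *v (u - y)"] right_diff_distrib)
      ultimately have "t * (c + (L *v (u - y)) \<bullet> (z - y)) \<le> t * (d + t * B)"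
        unfolding distrib_left by linarith
      then show ?thesis using t by simp
    qed
    have "((\<lambda>t. d + t * B) \<longlongrightarrow> d + 0 * B) (at_right 0)"
      by (intro tendsto_intros)
    moreover have "eventually (\<lambda>t. c + (L *v (u - y)) \<bullet> (z - y) \<le> d + t * B) (at_right 0)"
      using eventually_at_right_real[of 0 1] by (auto elim!: eventually_mono intro: ineq)
    ultimately have "c + (L *v (u - y)) \<bullet> (z - y) \<le> d + 0 * B"
      by (rule tendsto_lowerbound) simp
    then show ?thesis by (simp add: c real)
  qed (use ninf in auto)
  then show "r (prox L r u) + ereal ((L *v (u - prox L r u)) \<bullet> (z - prox L r u)) \<le> r z"
    by (simp add: y_def)
qed

text \<open>Each proximal point is tested in the variational inequality of the other, and the values
  of \<open>r\<close> cancel. All quadratic terms are put into the metric \<open>L1\<close>, so that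
  \<open>L2\<close> enters only through the discrepancy \<open>b\<close>; Cauchy-Schwarz
  finishes.\<close>

lemma prox_perturbation:
  fixes L1 L2 :: "real^'n^'n" and r :: "real^'n \<Rightarrow> ereal"
  assumes r: "convex_efun r" "lsc_efun r" "proper_fun r" and L: "pos_def L1" "pos_def L2"
    and m: "\<And>v. m * (norm v)\<^sup>2 \<le> v \<bullet> (L1 *v v)"
  shows "m * norm (prox L1 r u1 - prox L2 r u2)
         \<le> norm (L1 *v (u1 - prox L2 r u2) - L2 *v (u2 - prox L2 r u2))"
proof -
  define y1 y2 where "y1 = prox L1 r u1" and "y2 = prox L2 r u2"
  define d where "d = y1 - y2"
  define b where "b = L1 *v (u1 - y2) - L2 *v (u2 - y2)"
  obtain c1 c2 where c: "r y1 = ereal c1" "r y2 = ereal c2"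
    using prox_variational_inequality(1)[OF r] L r(3)
    by (metis (no_types, lifting) edom_def mem_Collect_eq proper_fun_def y1_def y2_def
        ereal_cases less_irrefl)
  have "c1 + (L1 *v (u1 - y1)) \<bullet> (y2 - y1) \<le> c2" "c2 + (L2 *v (u2 - y2)) \<bullet> (y1 - y2) \<le> c1"
    using prox_variational_inequality(2)[OF r L(1), of u1 y2]
      prox_variational_inequality(2)[OF r L(2), of u2 y1] c
    by (simp_all add: y1_def y2_def)
  then have "d \<bullet> (L1 *v d) \<le> b \<bullet> d"
    by (simp add: d_def b_def matrix_vector_mult_diff_distrib inner_diff_left inner_diff_right
        inner_commute algebra_simps)
  then have "m * (norm d)\<^sup>2 \<le> norm b * norm d"
    using m[of d] norm_cauchy_schwarz[of b d] by linarith
  then have "norm d * (m * norm d) \<le> norm d * norm b" by (simp add: power2_eq_square algebra_simps)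
  then have "m * norm d \<le> norm b" by (cases "d = 0") auto
  then show ?thesis by (simp add: d_def b_def y1_def y2_def)
qed

lemma continuous_on_prox:
  fixes L :: "real^'n^'n"
  assumes r: "convex_efun r" "lsc_efun r" "proper_fun r" and L: "pos_def L"
  shows "continuous_on UNIV (prox L r)"
proof -
  obtain m where m: "0 < m" "\<And>v. m * (norm v)\<^sup>2 \<le> v \<bullet> (L *v v)"
    using pos_def_coercive[OF L] by blast
  have "norm (prox L r u - prox L r w) \<le> norm (L *v (u - w)) / m" for u w
    using prox_perturbation[OF r L L m(2), of u w] m(1)
    by (simp add: matrix_vector_mult_diff_distrib divide_simps mult.commute)
  then have *: "dist (prox L r u) (prox L r w) \<le> norm (L *v (u - w)) / m" for u w
    by (simp add: dist_norm)
  have "(prox L r \<longlongrightarrow> prox L r w) (at w)" for w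
  proof (rule tendsto_dist_iff[THEN iffD2], rule tendsto_sandwich[where f = "\<lambda>_. 0"])
    show "((\<lambda>u. norm (L *v (u - w)) / m) \<longlongrightarrow> 0) (at w)"
      using m(1) bounded_linear.tendsto[OF matrix_vector_mul_bounded_linear[of L], of "\<lambda>u. u - w" 0]
      by (auto intro!: tendsto_eq_intros simp: LIM_zero)
  qed (use * in auto)
  then show ?thesis by (simp add: continuous_on_def)
qed

lemma FL_perturbation:
  fixes L1 L2 :: "real^'n^'n" and r :: "real^'n \<Rightarrow> ereal"
  assumes r: "convex_efun r" "lsc_efun r" "proper_fun r" and L: "pos_def L1" "pos_def L2"
    and m: "0 < m" "\<And>v. m * (norm v)\<^sup>2 \<le> v \<bullet> (L1 *v v)"
    and M: "\<And>v. norm (L1 *v v) \<le> M1 * norm v" "\<And>v. norm (L2 *v v) \<le> M2 * norm v"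
  shows "norm (FL L1 r G1 x1) \<le>
     (1 + (M1 + M2) / m) * norm (FL L2 r G2 x2) + (1 + M1 / m) * norm (x1 - x2) + norm (G1 x1 - G2 x2) / m"
proof -
  define F where "F = FL L2 r G2 x2"
  define y1 y2 where "y1 = prox L1 r (uL L1 G1 x1)" and "y2 = prox L2 r (uL L2 G2 x2)"
  have F: "F = x2 - y2" by (simp add: F_def FL_def y2_def)
  \<comment> \<open>Applying a metric to \<open>uL\<close> cancels its inverse:
    \<open>L *v uL L G x\<close> is \<open>L *v x - G x\<close>. The rest is
    \<open>x1 - y2 = (x1 - x2) + F\<close>.\<close>
  have "L1 *v (uL L1 G1 x1 - y2) - L2 *v (uL L2 G2 x2 - y2)
      = L1 *v (x1 - x2) + L1 *v F - L2 *v F - (G1 x1 - G2 x2)"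
    by (simp add: uL_def F matrix_vector_mult_diff_distrib pos_def_inv_cancel L)
  then have "m * norm (y1 - y2) \<le> norm (L1 *v (x1 - x2) + L1 *v F - L2 *v F - (G1 x1 - G2 x2))"
    using prox_perturbation[OF r L m(2)] by (metis y1_def y2_def)
  also have "\<dots> \<le> norm (L1 *v (x1 - x2)) + norm (L1 *v F) + norm (L2 *v F) + norm (G1 x1 - G2 x2)"
    by norm
  also have "\<dots> \<le> M1 * norm (x1 - x2) + M1 * norm F + M2 * norm F + norm (G1 x1 - G2 x2)"
    by (intro add_mono M order_refl)
  finally have "norm (y1 - y2) \<le> (M1 * norm (x1 - x2) + (M1 + M2) * norm F + norm (G1 x1 - G2 x2)) / m"
    using m by (simp add: divide_simps algebra_simps)
  moreover have "FL L1 r G1 x1 = F + (x1 - x2) - (y1 - y2)" by (simp add: F FL_def y1_def)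
  then have "norm (FL L1 r G1 x1) \<le> norm F + norm (x1 - x2) + norm (y1 - y2)"
    by (smt (verit) norm_triangle_ineq norm_triangle_ineq4)
  ultimately show ?thesis
    unfolding F_def[symmetric] by (simp add: add_divide_distrib algebra_simps)
qed

text \<open>By polarization, the quadratic form controls the operator norm of a symmetric matrix.\<close>

lemma pos_def_norm_bound:
  fixes L :: "real^'n^'n"
  assumes L: "pos_def L" and M: "loewner_le L (M *\<^sub>R mat 1)"
  shows "norm (L *v v) \<le> M * norm v"
proof (cases "L *v v = 0")
  case True
  \<comment> \<open>Only \<open>0 \<le> M * norm v\<close> is at stake here, and the sign of
    \<open>M\<close> comes from the quadratic form.\<close>
  have "0 \<le> v \<bullet> (L *v v)" using True by simp
  moreover have q: "v \<bullet> (L *v v) \<le> M * (norm v)\<^sup>2"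
    using M by (simp add: loewner_le_def scaleR_matrix_vector_assoc[symmetric] power2_norm_eq_inner)
  ultimately have "0 \<le> norm v * (M * norm v)" by (simp add: power2_eq_square algebra_simps)
  then show ?thesis using True by (cases "v = 0") (auto simp: zero_le_mult_iff)
next
  case False
  then have v0: "v \<noteq> 0" by auto
  \<comment> \<open>\<open>w\<close> is \<open>L *v v\<close> rescaled to the length of
    \<open>v\<close>: the inner product with \<open>L *v v\<close> becomes a product of norms, and
    the parallelogram law gives exactly \<open>4 * M * (norm v)\<^sup>2\<close>.\<close>
  define w where "w = (norm v / norm (L *v v)) *\<^sub>R (L *v v)"
  have q: "v \<bullet> (L *v v) \<le> M * (norm v)\<^sup>2" for v
    using M by (simp add: loewner_le_def scaleR_matrix_vector_assoc[symmetric] power2_norm_eq_inner)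
  have q0: "0 \<le> v \<bullet> (L *v v)" for v using mnorm_power2[OF L, of v] by (metis zero_le_power2)
  have wv: "norm w = norm v" using False by (simp add: w_def)
  have "4 * (w \<bullet> (L *v v)) = (v + w) \<bullet> (L *v (v + w)) - (v - w) \<bullet> (L *v (v - w))"
    using sym_mat_inner[of L v w] L
    by (simp add: pos_def_def matrix_vector_mult_diff_distrib matrix_vector_right_distrib
            inner_diff_left inner_diff_right inner_add_left inner_add_right inner_commute)
  also have "\<dots> \<le> (v + w) \<bullet> (L *v (v + w)) + (v - w) \<bullet> (L *v (v - w))" using q0[of "v - w"] by simp
  also have "\<dots> \<le> M * (norm (v + w))\<^sup>2 + M * (norm (v - w))\<^sup>2" by (intro add_mono q)
  also have "\<dots> = 4 * M * (norm v)\<^sup>2"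
  proof -
    have "(norm (v + w))\<^sup>2 + (norm (v - w))\<^sup>2 = 2 * (norm v)\<^sup>2 + 2 * (norm w)\<^sup>2"
      by (simp add: power2_norm_eq_inner inner_diff_left inner_diff_right inner_add_left inner_add_right)
    then show ?thesis by (simp add: wv distrib_left[symmetric])
  qed
  finally have "w \<bullet> (L *v v) \<le> M * (norm v)\<^sup>2" by simp
  moreover have "w \<bullet> (L *v v) = norm v * norm (L *v v)"
    using False by (simp add: w_def power2_norm_eq_inner[symmetric] power2_eq_square)
  ultimately have "norm v * norm (L *v v) \<le> norm v * (M * norm v)"
    by (simp add: power2_eq_square algebra_simps)
  then show ?thesis using v0 by simp
qed

section \<open>Measurability\<close>

text \<open>For a simple function in place of \<open>z\<close> the composition is patched together
  from finitely many measurable sections; continuity in the first argument carries measurability to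
  the pointwise limit.\<close>

lemma borel_measurable_caratheodory:
  fixes G :: "'b::{metric_space, second_countable_topology} \<Rightarrow> 'xi \<Rightarrow> 'c::metric_space"
  assumes cont: "\<And>\<xi>. \<xi> \<in> space X \<Longrightarrow> continuous_on UNIV (\<lambda>y. G y \<xi>)"
    and meas: "\<And>y. (\<lambda>\<xi>. G y \<xi>) \<in> borel_measurable X"
    and z: "z \<in> borel_measurable P" and s: "s \<in> measurable P X"
  shows "(\<lambda>\<omega>. G (z \<omega>) (s \<omega>)) \<in> borel_measurable P"
proof -
  obtain F where F: "\<And>i. simple_function P (F i)" "\<And>\<omega>. \<omega> \<in> space P \<Longrightarrow> (\<lambda>i. F i \<omega>) \<longlonglongrightarrow> z \<omega>"
    using borel_measurable_implies_sequence_metric[OF z, of undefined] by blast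
  show ?thesis
  proof (rule borel_measurable_LIMSEQ_metric)
    fix i
    have fin: "finite (F i ` space P)" using F(1)[of i] by (rule simple_functionD)
    show "(\<lambda>\<omega>. G (F i \<omega>) (s \<omega>)) \<in> borel_measurable P"
    proof (rule measurable_compose_countable'[where I = "F i ` space P" and g = "F i"])
      show "F i \<in> measurable P (count_space (F i ` space P))"
        using F(1)[of i] by (auto simp: simple_function_def measurable_count_space_eq2[OF fin])
      show "countable (F i ` space P)" using fin by (rule countable_finite)
    qed (use measurable_compose[OF s meas] in auto)
  next
    fix \<omega> assume \<omega>: "\<omega> \<in> space P"
    then have "s \<omega> \<in> space X" using s by (rule measurable_space[rotated])
    then have "isCont (\<lambda>y. G y (s \<omega>)) (z \<omega>)"
      using cont by (simp add: continuous_on_eq_continuous_at)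
    then show "(\<lambda>i. G (F i \<omega>) (s \<omega>)) \<longlonglongrightarrow> G (z \<omega>) (s \<omega>)"
      using F(2)[OF \<omega>] by (rule isCont_tendsto_compose)
  qed
qed

text \<open>A function whose graph is closed is Borel: its restriction to arguments with values in a
  compact set is a compact projection of a closed set.  This also covers functions that are
  constant off the projection of the closed relation.\<close>

lemma borel_measurable_closed_relation:
  fixes h :: "'a::euclidean_space \<Rightarrow> 'b::euclidean_space"
  assumes R: "closed {(y, x). R x y}" and h: "\<And>x y. R x y \<Longrightarrow> h x = y"
    and c: "\<And>x. \<not> (\<exists>y. R x y) \<Longrightarrow> h x = c"
  shows "h \<in> borel_measurable borel"
proof -
  have cl: "closed {x. \<exists>y\<in>C. R x y}" if C: "compact C" for C
  proof -
    show ?thesis using closed_compact_projection[OF C R] by (simp add: Bex_def)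
  qed
  have Bor: "{x. \<exists>y\<in>C. R x y} \<in> sets borel" if C: "closed C" for C
  proof -
    \<comment> \<open>Closed balls exhaust \<open>C\<close> by compact pieces, so its projection is
      a countable union of closed sets.\<close>
    have "\<exists>n::nat. \<exists>y\<in>C \<inter> cball 0 (real n). R x y" if "y \<in> C" "R x y" for x y
    proof -
      obtain n :: nat where "norm y \<le> real n" using real_arch_simple by blast
      then show ?thesis using that by (intro exI[of _ n] bexI[of _ y]) auto
    qed
    then have "{x. \<exists>y\<in>C. R x y} = (\<Union>n::nat. {x. \<exists>y\<in>C \<inter> cball 0 (real n). R x y})"
      by blast
    moreover have "closed {x. \<exists>y\<in>C \<inter> cball 0 (real n). R x y}" for n
      by (rule cl) (simp add: C closed_Int_compact)
    ultimately show ?thesis by auto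
  qed
  show ?thesis
    unfolding borel_eq_closed[where 'a='b]
  proof (safe intro!: measurable_measure_of)
    fix C :: "'b set" assume C: "closed C"
    \<comment> \<open>Arguments without a partner all take the value \<open>c\<close>, so they enter
      the preimage together or not at all.\<close>
    have eq: "h -` C = {x. \<exists>y\<in>C. R x y} \<union> (if c \<in> C then - {x. \<exists>y\<in>UNIV. R x y} else {})"
    proof (rule set_eqI)
      fix x show "x \<in> h -` C \<longleftrightarrow> x \<in> {x. \<exists>y\<in>C. R x y} \<union> (if c \<in> C then - {x. \<exists>y\<in>UNIV. R x y} else {})"
        by (cases "\<exists>y. R x y") (use h c in auto)
    qed
    have "- {x. \<exists>y\<in>UNIV. R x y} \<in> sets borel"
      using Bor[OF closed_UNIV] by (intro borel_comp)
    then show "h -` C \<inter> space borel \<in> sets borel"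
      using Bor[OF C] by (simp add: eq)
  qed simp_all
qed

text \<open>By symmetry of the four products, \<open>A ** X\<close> and \<open>A ** Y\<close> are
  the same projection, and likewise \<open>X ** A\<close> and \<open>Y ** A\<close>; then
  \<open>X = X ** A ** X = Y ** A ** Y\<close>.\<close>

lemma penrose_unique:
  fixes A X Y :: "real^'n^'n"
  assumes "A ** X ** A = A" "X ** A ** X = X" "transpose (A ** X) = A ** X" "transpose (X ** A) = X ** A"
    and "A ** Y ** A = A" "Y ** A ** Y = Y" "transpose (A ** Y) = A ** Y" "transpose (Y ** A) = Y ** A"
  shows "X = Y"
proof -
  have "A ** X = transpose (A ** Y ** A ** X)"
    using assms by simp
  also have "\<dots> = transpose (A ** X) ** transpose (A ** Y)"
    by (simp add: matrix_transpose_mul matrix_mul_assoc)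
  also have "\<dots> = A ** X ** A ** Y" using assms by (simp add: matrix_mul_assoc)
  also have "\<dots> = A ** Y" using assms by simp
  finally have 1: "A ** X = A ** Y" .
  have "X ** A = transpose (X ** (A ** Y ** A))"
    using assms by simp
  also have "\<dots> = transpose (Y ** A) ** transpose (X ** A)"
    by (simp add: matrix_transpose_mul matrix_mul_assoc)
  also have "\<dots> = Y ** (A ** X ** A)" by (simp only: assms(4,8) matrix_mul_assoc)
  also have "\<dots> = Y ** A" using assms by simp
  finally have 2: "X ** A = Y ** A" .
  have "X = X ** (A ** X)" using assms by (simp add: matrix_mul_assoc)
  also have "\<dots> = (Y ** A) ** Y" by (simp only: 1 2 matrix_mul_assoc)
  finally show ?thesis using assms by simp
qed

lemma continuous_on_matrix_mul [continuous_intros]: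
  fixes A B :: "'a::topological_space \<Rightarrow> real^'n^'n"
  assumes "continuous_on S A" "continuous_on S B"
  shows "continuous_on S (\<lambda>x. A x ** B x)"
  unfolding matrix_matrix_mult_def by (intro continuous_intros assms)

lemma continuous_on_transpose [continuous_intros]:
  fixes A :: "'a::topological_space \<Rightarrow> real^'n^'n"
  assumes "continuous_on S A"
  shows "continuous_on S (\<lambda>x. transpose (A x))"
  unfolding transpose_def by (intro continuous_intros assms)

text \<open>Existence of the Moore--Penrose inverse is not needed: off the set where it exists,
  \<open>THE\<close> picks one fixed value.\<close>

lemma borel_measurable_pinv: "(pinv :: real^'n^'n \<Rightarrow> real^'n^'n) \<in> borel_measurable borel"
proof (rule borel_measurable_closed_relation)
  define R where "R = (\<lambda>A X :: real^'n^'n. A ** X ** A = A \<and> X ** A ** X = X \<and>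
                    transpose (A ** X) = A ** X \<and> transpose (X ** A) = X ** A)"
  have pinv: "pinv A = (THE X. R A X)" for A by (simp add: pinv_def R_def)
  show "closed {(X, A). R A X}"
    unfolding R_def case_prod_beta
    by (intro closed_Collect_conj closed_Collect_eq continuous_intros)
  show "pinv A = X" if "R A X" for A X
    unfolding pinv
  proof (rule the_equality)
    show "R A X" by (rule that)
    fix Y assume "R A Y"
    with that show "Y = X" unfolding R_def by (elim conjE) (rule penrose_unique)
  qed
  show "pinv A = (THE X. False)" if "\<not> (\<exists>X. R A X)" for A
  proof -
    have "R A X = False" for X using that by blast
    then show ?thesis by (simp only: pinv)
  qed
qed

lemma borel_measurable_filt:
  assumes s: "\<And>k i. i < ng k \<Longrightarrow> s k i \<in> measurable P X"
    and t: "\<And>k j. j < nh k \<Longrightarrow> t k j \<in> measurable P X"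
    and f: "f \<in> borel_measurable (filt P X s ng t nh k)"
  shows "f \<in> borel_measurable P"
proof (rule measurable_mono[THEN subsetD, OF order_refl _ _ _ f])
  show "sets (filt P X s ng t nh k) \<subseteq> sets P"
    unfolding filt_def
    by (subst sets_measure_of) (auto intro!: sets.sigma_sets_subset dest: measurable_sets[OF s] measurable_sets[OF t])
  show "space (filt P X s ng t nh k) = space P" unfolding filt_def by (rule space_measure_of) auto
qed simp

lemma borel_measurable_matrix_vector_mult:
  fixes A :: "'a \<Rightarrow> real^'n^'n" and v :: "'a \<Rightarrow> real^'n"
  assumes "A \<in> borel_measurable M" "v \<in> borel_measurable M"
  shows "(\<lambda>\<omega>. A \<omega> *v v \<omega>) \<in> borel_measurable M"
proof (rule borel_measurable_continuous_Pair[OF assms])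
  show "continuous_on UNIV (\<lambda>x::(real^'n^'n) \<times> (real^'n). fst x *v snd x)"
    unfolding matrix_vector_mult_def by (intro continuous_intros)
qed

section \<open>Energy estimates\<close>

text \<open>A discrete Gronwall inequality, from
  \<open>1 + \<nu> k \<le> exp (\<nu> k)\<close>.\<close>

lemma perturbed_growth_bound:
  fixes \<theta> \<nu> \<epsilon> :: "nat \<Rightarrow> real"
  assumes "\<And>k. 0 \<le> \<theta> k" "\<And>k. 0 \<le> \<nu> k" "\<And>k. 0 \<le> \<epsilon> k"
    and step: "\<And>k. \<theta> (Suc k) \<le> (1 + \<nu> k) * \<theta> k + \<epsilon> k"
  shows "\<theta> k \<le> exp (\<Sum>j<k. \<nu> j) * (\<theta> 0 + (\<Sum>j<k. \<epsilon> j))"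
proof (induction k)
  case (Suc k)
  define S where "S = \<theta> 0 + (\<Sum>j<k. \<epsilon> j)"
  have S: "0 \<le> S" using assms by (simp add: S_def sum_nonneg)
  have "\<theta> (Suc k) \<le> (1 + \<nu> k) * \<theta> k + \<epsilon> k" by (rule step)
  also have "\<dots> \<le> (1 + \<nu> k) * (exp (\<Sum>j<k. \<nu> j) * S) + \<epsilon> k"
    using Suc.IH assms by (intro add_right_mono mult_left_mono) (auto simp: S_def)
  also have "\<dots> \<le> exp (\<nu> k) * (exp (\<Sum>j<k. \<nu> j) * S) + exp (\<Sum>j<Suc k. \<nu> j) * \<epsilon> k"
  proof (rule add_mono)
    show "(1 + \<nu> k) * (exp (\<Sum>j<k. \<nu> j) * S) \<le> exp (\<nu> k) * (exp (\<Sum>j<k. \<nu> j) * S)"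
      using S by (intro mult_right_mono) auto
    have "1 \<le> exp (\<Sum>j<Suc k. \<nu> j)" using assms by (subst one_le_exp_iff) (rule sum_nonneg)
    then show "\<epsilon> k \<le> exp (\<Sum>j<Suc k. \<nu> j) * \<epsilon> k"
      using assms(3)[of k] mult_right_mono by fastforce
  qed
  also have "\<dots> = exp (\<Sum>j<Suc k. \<nu> j) * (\<theta> 0 + (\<Sum>j<Suc k. \<epsilon> j))"
    by (simp add: S_def exp_add algebra_simps)
  finally show ?case .
qed (use assms in auto)

text \<open>A weighted geometric mean is at most the larger argument. This makes the increase
  allowed in the Newton test linear in \<open>\<theta>\<close>.\<close>

lemma powr_interpolation_le:
  fixes a b p :: real
  assumes "0 \<le> a" "0 \<le> b" "0 < p" "p < 1"
  shows "a powr (1 - p) * b powr p \<le> a + b"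
proof -
  define m where "m = max a b"
  have "a powr (1 - p) * b powr p \<le> m powr (1 - p) * m powr p"
    using assms by (intro mult_mono powr_mono2) (auto simp: m_def)
  also have "\<dots> = m" using assms by (simp add: powr_add[symmetric] m_def)
  also have "\<dots> \<le> a + b" using assms by (simp add: m_def)
  finally show ?thesis .
qed

text \<open>The terms eventually drop below 1, where lowering the exponent from 1 to
  \<open>p\<close> enlarges them.\<close>

lemma summable_of_powr_summable:
  fixes \<epsilon> :: "nat \<Rightarrow> real"
  assumes "\<And>k. 0 \<le> \<epsilon> k" "0 < p" "p < 1" "summable (\<lambda>k. \<epsilon> k powr p)"
  shows "summable \<epsilon>"
proof (rule summable_comparison_test_ev[OF _ assms(4)])
  have "eventually (\<lambda>k. \<epsilon> k powr p < 1) sequentially"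
    using summable_LIMSEQ_zero[OF assms(4)] by (rule order_tendstoD) simp
  then show "eventually (\<lambda>k. norm (\<epsilon> k) \<le> \<epsilon> k powr p) sequentially"
  proof eventually_elim
    case (elim k)
    then have "\<epsilon> k \<le> 1" using assms(2) ge_one_powr_ge_zero[of "\<epsilon> k" p] by linarith
    then have "\<epsilon> k powr 1 \<le> \<epsilon> k powr p" using assms by (intro powr_mono') auto
    then show ?case using assms(1)[of k] by simp
  qed
qed

text \<open>The abstract energy estimate along one path: \<open>W\<close> is the squared residual, \<open>v\<close> the norm of
  the stochastic residual, \<open>e\<close> the squared gradient error and \<open>\<phi>\<close> the objective.  A Newton step
  (second alternative) may increase \<open>\<phi>\<close>, but it contracts \<open>\<theta>\<close>, so the sum of \<open>\<theta>\<close> over Newton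
  steps is controlled by the telescoping slack \<open>D\<close>.\<close>

lemma path_energy_bound:
  fixes \<phi> \<theta> W v e :: "nat \<Rightarrow> 'w \<Rightarrow> real" and \<alpha> \<nu> \<epsilon>1 \<epsilon>2 :: "nat \<Rightarrow> real" and p \<eta> \<beta> \<theta>init \<phi>init b C c \<delta> :: real
  assumes \<alpha>: "\<And>k. 0 \<le> \<alpha> k" "\<And>k. \<alpha> k \<le> 1" "decseq \<alpha>"
    and \<nu>: "\<And>k. 0 \<le> \<nu> k" "summable \<nu>"
    and \<epsilon>1: "\<And>k. 0 \<le> \<epsilon>1 k" "summable \<epsilon>1" and \<epsilon>2: "\<And>k. 0 \<le> \<epsilon>2 k" "summable \<epsilon>2"
    and \<eta>: "0 < \<eta>" "\<eta> < 1" and p: "0 < p" "p < 1" and \<beta>: "0 < \<beta>" and \<theta>init: "0 \<le> \<theta>init"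
    and C: "0 \<le> C" and c: "0 \<le> c" and \<delta>: "0 < \<delta>"
    and init: "\<And>\<omega>. \<omega> \<in> \<Omega> \<Longrightarrow> \<phi> 0 \<omega> = \<phi>init" "\<And>\<omega>. \<omega> \<in> \<Omega> \<Longrightarrow> \<theta> 0 \<omega> = \<theta>init"
    and \<theta>: "\<And>k \<omega>. \<omega> \<in> \<Omega> \<Longrightarrow> 0 \<le> \<theta> k \<omega>" and e: "\<And>k \<omega>. \<omega> \<in> \<Omega> \<Longrightarrow> 0 \<le> e k \<omega>"
    and W: "\<And>k \<omega>. \<omega> \<in> \<Omega> \<Longrightarrow> 0 \<le> W k \<omega>" and b: "\<And>k \<omega>. \<omega> \<in> \<Omega> \<Longrightarrow> b \<le> \<phi> k \<omega>"
    and alt: "\<And>k \<omega>. \<omega> \<in> \<Omega> \<Longrightarrow>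
         \<theta> (Suc k) \<omega> = \<theta> k \<omega>
             \<and> \<phi> (Suc k) \<omega> \<le> \<phi> k \<omega> - \<alpha> k * \<delta> * (v k \<omega>)\<^sup>2 + \<alpha> k * c * e k \<omega>
             \<and> W (Suc k) \<omega> \<le> C * ((v k \<omega>)\<^sup>2 + e k \<omega>)
         \<or> \<theta> (Suc k) \<omega> \<le> (\<eta> + \<nu> k) * \<theta> k \<omega> + \<epsilon>1 k
             \<and> \<phi> (Suc k) \<omega> \<le> \<phi> k \<omega> + (\<beta> * \<theta> k \<omega> powr (1 - p) * \<theta> (Suc k) \<omega> powr p + \<epsilon>2 k)
             \<and> W (Suc k) \<omega> \<le> C * ((\<theta> (Suc k) \<omega>)\<^sup>2 + e (Suc k) \<omega>)"
  obtains C0 C1 where "0 \<le> C0" "0 \<le> C1"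
    "\<And>\<omega> K. \<omega> \<in> \<Omega> \<Longrightarrow> (\<Sum>k<K. \<alpha> (Suc k) * W (Suc k) \<omega>) \<le> C0 + C1 * (\<Sum>k\<le>K. \<alpha> k * e k \<omega>)"
proof -
  \<comment> \<open>\<open>\<Theta>\<close> bounds \<open>\<theta>\<close> on every path and
    \<open>S\<close> bounds the total slack. \<open>A\<close> turns descent of \<open>\<phi>\<close>
    into \<open>C\<close> times the squared residual; \<open>B\<close> pays for a Newton step,
    \<open>A * \<beta>\<close> for the increase of \<open>\<phi>\<close> and
    \<open>C * \<Theta>\<close> for the squared residual; \<open>E\<close> weighs the gradient
    errors.\<close>
  define \<Theta> where "\<Theta> = exp (suminf \<nu>) * (\<theta>init + suminf \<epsilon>1)"
  define A where "A = C / \<delta>"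
  define B where "B = A * \<beta> + C * \<Theta>"
  define S where "S = \<Theta> * suminf \<nu> + suminf \<epsilon>1"
  define E where "E = C + A * c"
  define C0 where "C0 = A * \<bar>\<phi>init - b\<bar> + B * (2 / (1 - \<eta>) * (\<theta>init + S) + S) + A * suminf \<epsilon>2"
  have \<Theta>: "0 \<le> \<Theta>" using \<theta>init \<epsilon>1 by (simp add: \<Theta>_def suminf_nonneg)
  have A: "0 \<le> A" using C \<delta> by (simp add: A_def)
  have B: "0 \<le> B" using A \<Theta> C \<beta> by (simp add: B_def)
  have S: "0 \<le> S" using \<Theta> \<nu> \<epsilon>1 by (simp add: S_def suminf_nonneg)
  have E: "0 \<le> E" "C \<le> E" using A C c by (auto simp: E_def)
  have "0 \<le> C0" using A B S \<theta>init \<eta> \<epsilon>2 by (auto simp: C0_def suminf_nonneg intro!: add_nonneg_nonneg mult_nonneg_nonneg)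
  moreover have "0 \<le> 2 * E" using E by simp
  moreover have "(\<Sum>k<K. \<alpha> (Suc k) * W (Suc k) \<omega>) \<le> C0 + 2 * E * (\<Sum>k\<le>K. \<alpha> k * e k \<omega>)"
    if \<omega>: "\<omega> \<in> \<Omega>" for \<omega> K
  proof -
    note init = init[OF \<omega>] and \<theta> = \<theta>[OF \<omega>] and e = e[OF \<omega>] and W = W[OF \<omega>] and b = b[OF \<omega>] and alt = alt[OF \<omega>]
    have grow: "\<theta> (Suc k) \<omega> \<le> (1 + \<nu> k) * \<theta> k \<omega> + \<epsilon>1 k" for k
      using alt[of k]
    proof
      assume "\<theta> (Suc k) \<omega> \<le> (\<eta> + \<nu> k) * \<theta> k \<omega> + \<epsilon>1 k \<and> \<phi> (Suc k) \<omega> \<le> \<phi> k \<omega> + (\<beta> * \<theta> k \<omega> powr (1 - p) * \<theta> (Suc k) \<omega> powr p + \<epsilon>2 k)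
             \<and> W (Suc k) \<omega> \<le> C * ((\<theta> (Suc k) \<omega>)\<^sup>2 + e (Suc k) \<omega>)"
      moreover have "(\<eta> + \<nu> k) * \<theta> k \<omega> \<le> (1 + \<nu> k) * \<theta> k \<omega>" using \<eta> \<theta> by (intro mult_right_mono) auto
      ultimately show ?thesis by linarith
    next
      assume "\<theta> (Suc k) \<omega> = \<theta> k \<omega> \<and> \<phi> (Suc k) \<omega> \<le> \<phi> k \<omega> - \<alpha> k * \<delta> * (v k \<omega>)\<^sup>2 + \<alpha> k * c * e k \<omega>
             \<and> W (Suc k) \<omega> \<le> C * ((v k \<omega>)\<^sup>2 + e k \<omega>)"
      then show ?thesis using \<nu>(1)[of k] \<epsilon>1(1)[of k] \<theta>[of k] by (simp add: distrib_right)
    qed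
    have le\<Theta>: "\<theta> k \<omega> \<le> \<Theta>" for k
    proof -
      have "\<theta> k \<omega> \<le> exp (\<Sum>j<k. \<nu> j) * (\<theta> 0 \<omega> + (\<Sum>j<k. \<epsilon>1 j))"
        by (rule perturbed_growth_bound[where \<theta> = "\<lambda>k. \<theta> k \<omega>"]) (fact \<theta> \<nu>(1) \<epsilon>1(1) grow)+
      also have "\<dots> \<le> \<Theta>"
        unfolding \<Theta>_def init using \<nu> \<epsilon>1 \<theta>init
        by (intro mult_mono add_left_mono sum_le_suminf) (auto intro!: sum_le_suminf sum_nonneg add_nonneg_nonneg)
      finally show ?thesis .
    qed
    \<comment> \<open>\<open>D\<close> telescopes up to slack and is nonnegative at every step. At a
      Newton step \<open>(1 - \<eta>) * \<theta> k \<omega> \<le> D k\<close>, so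
      \<open>\<tau> k\<close> majorizes the old and new \<open>\<theta>\<close> together, whence the
      factor 2.\<close>
    define D where "D = (\<lambda>k. \<theta> k \<omega> - \<theta> (Suc k) \<omega> + (\<Theta> * \<nu> k + \<epsilon>1 k))"
    define \<tau> where "\<tau> = (\<lambda>k. 2 / (1 - \<eta>) * D k + (\<Theta> * \<nu> k + \<epsilon>1 k))"
    have \<nu>\<Theta>: "\<nu> k * \<theta> k \<omega> \<le> \<Theta> * \<nu> k" for k using mult_left_mono[OF le\<Theta>[of k] \<nu>(1)[of k]] by (simp add: mult.commute)
    have D: "0 \<le> D k" for k using grow[of k] \<nu>\<Theta>[of k] by (simp add: D_def algebra_simps)
    have \<tau>0: "0 \<le> \<tau> k" for k using D[of k] \<eta> \<Theta> \<nu>(1)[of k] \<epsilon>1(1)[of k] by (simp add: \<tau>_def)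
    \<comment> \<open>One inequality valid for both alternatives, so that the sum over
      \<open>k\<close> need not separate Newton from proximal steps.\<close>
    have step: "\<alpha> (Suc k) * W (Suc k) \<omega> \<le> A * (\<phi> k \<omega> - \<phi> (Suc k) \<omega>) + B * \<tau> k + A * \<epsilon>2 k
        + E * (\<alpha> k * e k \<omega> + \<alpha> (Suc k) * e (Suc k) \<omega>)" for k
      using alt[of k]
    proof
      assume a: "\<theta> (Suc k) \<omega> = \<theta> k \<omega> \<and> \<phi> (Suc k) \<omega> \<le> \<phi> k \<omega> - \<alpha> k * \<delta> * (v k \<omega>)\<^sup>2 + \<alpha> k * c * e k \<omega>
             \<and> W (Suc k) \<omega> \<le> C * ((v k \<omega>)\<^sup>2 + e k \<omega>)"
      \<comment> \<open>The new residual is charged to the step that produced it, whose descent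
        carries the weight \<open>\<alpha> k\<close>; monotonicity makes this weight
        sufficient.\<close>
      have "\<alpha> (Suc k) \<le> \<alpha> k" using \<alpha>(3) by (simp add: decseq_Suc_iff)
      then have "\<alpha> (Suc k) * W (Suc k) \<omega> \<le> \<alpha> k * (C * ((v k \<omega>)\<^sup>2 + e k \<omega>))"
        using a W \<alpha> by (intro mult_mono) auto
      also have "\<dots> = A * (\<alpha> k * \<delta> * (v k \<omega>)\<^sup>2) + C * (\<alpha> k * e k \<omega>)" using \<delta> by (simp add: A_def algebra_simps)
      also have "\<dots> \<le> A * (\<phi> k \<omega> - \<phi> (Suc k) \<omega> + \<alpha> k * c * e k \<omega>) + C * (\<alpha> k * e k \<omega>)"
        using a A by (intro add_right_mono mult_left_mono) auto
      also have "\<dots> = A * (\<phi> k \<omega> - \<phi> (Suc k) \<omega>) + E * (\<alpha> k * e k \<omega>)" by (simp add: E_def algebra_simps)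
      also have "\<dots> \<le> A * (\<phi> k \<omega> - \<phi> (Suc k) \<omega>) + B * \<tau> k + A * \<epsilon>2 k
        + E * (\<alpha> k * e k \<omega> + \<alpha> (Suc k) * e (Suc k) \<omega>)"
        using A B E \<tau>0[of k] \<epsilon>2(1)[of k] \<alpha>(1)[of "Suc k"] e[of "Suc k"] by (simp add: distrib_left)
      finally show ?thesis .
    next
      assume a: "\<theta> (Suc k) \<omega> \<le> (\<eta> + \<nu> k) * \<theta> k \<omega> + \<epsilon>1 k
             \<and> \<phi> (Suc k) \<omega> \<le> \<phi> k \<omega> + (\<beta> * \<theta> k \<omega> powr (1 - p) * \<theta> (Suc k) \<omega> powr p + \<epsilon>2 k)
             \<and> W (Suc k) \<omega> \<le> C * ((\<theta> (Suc k) \<omega>)\<^sup>2 + e (Suc k) \<omega>)"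
      have "(1 - \<eta>) * \<theta> k \<omega> \<le> D k" using a \<nu>\<Theta>[of k] by (simp add: D_def algebra_simps)
      then have "\<theta> k \<omega> \<le> 1 / (1 - \<eta>) * D k" using \<eta> by (simp add: field_simps)
      moreover have "\<theta> (Suc k) \<omega> \<le> \<theta> k \<omega> + (\<Theta> * \<nu> k + \<epsilon>1 k)" using D[of k] by (simp add: D_def)
      ultimately have \<tau>: "\<theta> k \<omega> + \<theta> (Suc k) \<omega> \<le> \<tau> k" by (simp add: \<tau>_def)
      have "\<beta> * (\<theta> k \<omega> powr (1 - p) * \<theta> (Suc k) \<omega> powr p) \<le> \<beta> * \<tau> k"
        using powr_interpolation_le[OF \<theta> \<theta> p, of k "Suc k"] \<tau> \<beta> by (intro mult_left_mono) auto
      then have "\<phi> (Suc k) \<omega> \<le> \<phi> k \<omega> + \<beta> * \<tau> k + \<epsilon>2 k" using a by (simp add: mult.assoc)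
      then have "0 \<le> A * (\<phi> k \<omega> - \<phi> (Suc k) \<omega> + \<beta> * \<tau> k + \<epsilon>2 k)" using A by simp
      then have 1: "0 \<le> A * (\<phi> k \<omega> - \<phi> (Suc k) \<omega>) + A * \<beta> * \<tau> k + A * \<epsilon>2 k" by (simp add: algebra_simps)
      \<comment> \<open>One factor is bounded uniformly, the other by the summable majorant;
        \<open>\<alpha> \<le> 1\<close> then absorbs the weight.\<close>
      have "\<theta> (Suc k) \<omega> * \<theta> (Suc k) \<omega> \<le> \<Theta> * \<tau> k"
        using le\<Theta>[of "Suc k"] \<tau> \<theta>[of k] \<theta>[of "Suc k"] \<Theta> by (intro mult_mono) auto
      then have "\<alpha> (Suc k) * (\<theta> (Suc k) \<omega>)\<^sup>2 \<le> 1 * (\<Theta> * \<tau> k)"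
        using \<alpha> by (intro mult_mono) (auto simp: power2_eq_square)
      then have "C * (\<alpha> (Suc k) * (\<theta> (Suc k) \<omega>)\<^sup>2) \<le> C * (\<Theta> * \<tau> k)" using C by (intro mult_left_mono) auto
      moreover have "\<alpha> (Suc k) * W (Suc k) \<omega> \<le> \<alpha> (Suc k) * (C * ((\<theta> (Suc k) \<omega>)\<^sup>2 + e (Suc k) \<omega>))"
        using a \<alpha> by (intro mult_left_mono) auto
      ultimately have "\<alpha> (Suc k) * W (Suc k) \<omega> \<le> C * \<Theta> * \<tau> k + C * (\<alpha> (Suc k) * e (Suc k) \<omega>)"
        by (simp add: algebra_simps)
      moreover have "C * (\<alpha> (Suc k) * e (Suc k) \<omega>) \<le> E * (\<alpha> (Suc k) * e (Suc k) \<omega>)"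
        using E \<alpha> e by (intro mult_right_mono) auto
      moreover have "0 \<le> E * (\<alpha> k * e k \<omega>)" using E \<alpha> e by simp
      ultimately show ?thesis using 1 by (simp add: B_def distrib_left distrib_right)
    qed
    have "(\<Sum>k<K. \<alpha> (Suc k) * W (Suc k) \<omega>) \<le> (\<Sum>k<K. A * (\<phi> k \<omega> - \<phi> (Suc k) \<omega>) + B * \<tau> k + A * \<epsilon>2 k
        + E * (\<alpha> k * e k \<omega> + \<alpha> (Suc k) * e (Suc k) \<omega>))"
      by (intro sum_mono step)
    also have "\<dots> = A * (\<phi> 0 \<omega> - \<phi> K \<omega>) + B * (\<Sum>k<K. \<tau> k) + A * (\<Sum>k<K. \<epsilon>2 k)
        + E * ((\<Sum>k<K. \<alpha> k * e k \<omega>) + (\<Sum>k<K. \<alpha> (Suc k) * e (Suc k) \<omega>))"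
      by (simp add: sum.distrib sum_distrib_left[symmetric] sum_lessThan_telescope'[of "\<lambda>k. \<phi> k \<omega>" K])
    \<comment> \<open>The error sum and its shift by one both lie below the sum up to
      \<open>K\<close> inclusive, which yields the coefficient \<open>2 * E\<close>.\<close>
    also have "\<dots> \<le> A * \<bar>\<phi>init - b\<bar> + B * (2 / (1 - \<eta>) * (\<theta>init + S) + S) + A * suminf \<epsilon>2
        + E * ((\<Sum>k\<le>K. \<alpha> k * e k \<omega>) + (\<Sum>k\<le>K. \<alpha> k * e k \<omega>))"
    proof (intro add_mono mult_left_mono A B E)
      show "\<phi> 0 \<omega> - \<phi> K \<omega> \<le> \<bar>\<phi>init - b\<bar>" using b[of K] init by simp
      have S': "(\<Sum>k<K. \<Theta> * \<nu> k + \<epsilon>1 k) \<le> S"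
        unfolding sum.distrib sum_distrib_left[symmetric] S_def
        using \<Theta> \<nu> \<epsilon>1 by (intro add_mono mult_left_mono sum_le_suminf) auto
      have "(\<Sum>k<K. D k) = \<theta>init - \<theta> K \<omega> + (\<Sum>k<K. \<Theta> * \<nu> k + \<epsilon>1 k)"
        by (simp add: D_def sum.distrib sum_lessThan_telescope'[of "\<lambda>k. \<theta> k \<omega>" K] init)
      also have "\<dots> \<le> \<theta>init + S" using S' \<theta>[of K] by simp
      finally have "2 / (1 - \<eta>) * (\<Sum>k<K. D k) \<le> 2 / (1 - \<eta>) * (\<theta>init + S)"
        using \<eta> by (intro mult_left_mono) auto
      then show "(\<Sum>k<K. \<tau> k) \<le> 2 / (1 - \<eta>) * (\<theta>init + S) + S"
        using S' by (simp only: \<tau>_def sum.distrib[of "\<lambda>k. 2 / (1 - \<eta>) * D k"] sum_distrib_left[symmetric])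
      show "(\<Sum>k<K. \<epsilon>2 k) \<le> suminf \<epsilon>2" using \<epsilon>2 by (intro sum_le_suminf) auto
      show "(\<Sum>k<K. \<alpha> k * e k \<omega>) \<le> (\<Sum>k\<le>K. \<alpha> k * e k \<omega>)"
        using \<alpha> e by (intro sum_mono2) auto
      show "(\<Sum>k<K. \<alpha> (Suc k) * e (Suc k) \<omega>) \<le> (\<Sum>k\<le>K. \<alpha> k * e k \<omega>)"
        using \<alpha> e by (simp add: sum.atMost_shift)
    qed
    finally show ?thesis by (simp add: C0_def algebra_simps)
  qed
  ultimately show thesis by (rule that)
qed

text \<open>A tail of \<open>X\<close> above \<open>c\<close> would bound \<open>c\<close> times the
  tail sum of the weights by a finite number.\<close>

lemma not_eventually_ge_of_weighted_suminf_finite: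
  fixes \<alpha> :: "nat \<Rightarrow> real" and X :: "nat \<Rightarrow> ennreal"
  assumes \<alpha>: "\<And>k. 0 \<le> \<alpha> k" "\<not> summable \<alpha>" and fin: "(\<Sum>k. ennreal (\<alpha> k) * X k) < \<infinity>" and c: "0 < c"
  shows "\<not> eventually (\<lambda>k. ennreal c \<le> X k) sequentially"
proof
  assume "eventually (\<lambda>k. ennreal c \<le> X k) sequentially"
  then obtain N where N: "\<And>k. N \<le> k \<Longrightarrow> ennreal c \<le> X k" by (auto simp: eventually_sequentially)
  have "ennreal c * (\<Sum>k. ennreal (\<alpha> (k + N))) = (\<Sum>k. ennreal c * ennreal (\<alpha> (k + N)))"
    by (rule ennreal_suminf_cmult[symmetric])
  also have "\<dots> \<le> (\<Sum>k. ennreal (\<alpha> (k + N)) * X (k + N))"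
    using N by (intro suminf_le) (auto simp: mult.commute[of "ennreal c"] intro!: mult_left_mono)
  also have "\<dots> \<le> (\<Sum>k. ennreal (\<alpha> k) * X k)"
    by (subst suminf_offset[of "\<lambda>k. ennreal (\<alpha> k) * X k" N]) (auto intro: add_increasing)
  finally have "(\<Sum>k. ennreal (\<alpha> (k + N))) \<noteq> top" using fin c
    by (auto simp: ennreal_mult_top)
  then have "summable (\<lambda>k. \<alpha> (k + N))" using \<alpha> by (intro summable_suminf_not_top) auto
  then show False using \<alpha> by (simp add: summable_iff_shift)
qed

text \<open>A positive lower limit would keep \<open>X\<close> eventually above a positive constant.
  Starting the sum at index 1 affects neither the divergence of the weights nor the lower
  limit.\<close>

lemma liminf_zero_of_weighted_suminf_finite:
  fixes \<alpha> :: "nat \<Rightarrow> real" and X :: "nat \<Rightarrow> ennreal"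
  assumes \<alpha>: "\<And>k. 0 \<le> \<alpha> k" "\<not> summable \<alpha>" and fin: "(\<Sum>k. ennreal (\<alpha> (Suc k)) * X (Suc k)) < \<infinity>"
  shows "liminf X = 0"
    and "\<And>y. (\<And>k. X k = ennreal ((y k)\<^sup>2)) \<Longrightarrow> (\<And>k. 0 \<le> y k) \<Longrightarrow> liminf (\<lambda>k. ereal (y k)) = 0"
proof -
  have \<alpha>': "\<not> summable (\<lambda>k. \<alpha> (Suc k))" using \<alpha> by (simp add: summable_Suc_iff)
  have inf: "\<not> eventually (\<lambda>k. ennreal c \<le> X k) sequentially" if "0 < c" for c
    using not_eventually_ge_of_weighted_suminf_finite[OF \<alpha>(1) \<alpha>' fin that]
    by (subst (asm) eventually_sequentially_Suc)
  show "liminf X = 0"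
  proof (rule ccontr)
    assume "liminf X \<noteq> 0"
    then obtain c where c: "0 < c" "c < liminf X" using dense[of 0 "liminf X"] by (auto simp: zero_less_iff_neq_zero)
    then obtain c' where c': "c = ennreal c'" "0 < c'"
      by (cases c) (auto simp: top_unique less_top[symmetric] dest: leD)
    have "eventually (\<lambda>k. c < X k) sequentially" using c by (intro less_LiminfD)
    then have "eventually (\<lambda>k. ennreal c' \<le> X k) sequentially"
      by eventually_elim (simp add: c')
    then show False using inf c' by blast
  qed
  show "liminf (\<lambda>k. ereal (y k)) = 0" if y: "\<And>k. X k = ennreal ((y k)\<^sup>2)" "\<And>k. 0 \<le> y k" for y
  proof (rule antisym)
    show "0 \<le> liminf (\<lambda>k. ereal (y k))" by (rule Liminf_bounded) (simp add: y)
    show "liminf (\<lambda>k. ereal (y k)) \<le> 0"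
    proof (rule ccontr)
      assume "\<not> liminf (\<lambda>k. ereal (y k)) \<le> 0"
      then obtain c where c: "0 < ereal c" "ereal c < liminf (\<lambda>k. ereal (y k))"
        using ereal_dense2[of 0 "liminf (\<lambda>k. ereal (y k))"] by (auto simp: not_le)
      have "eventually (\<lambda>k. ereal c < ereal (y k)) sequentially" using c by (intro less_LiminfD)
      then have "eventually (\<lambda>k. ennreal (c\<^sup>2) \<le> X k) sequentially"
        by eventually_elim (use c in \<open>auto simp: y intro!: ennreal_leI power_mono\<close>)
      then show False using inf[of "c\<^sup>2"] c by simp
    qed
  qed
qed

text \<open>Integrating the pathwise bound gives a bound on the expected partial sums that is
  uniform in \<open>K\<close>, since the expected errors are summable against
  \<open>\<alpha>\<close>.\<close>

lemma (in prob_space) liminf_of_expected_energy_bound: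
  fixes \<alpha> \<sigma> :: "nat \<Rightarrow> real" and y e :: "nat \<Rightarrow> 'a \<Rightarrow> real"
  assumes \<alpha>: "\<And>k. 0 \<le> \<alpha> k" "\<not> summable \<alpha>" and \<alpha>\<sigma>: "summable (\<lambda>k. \<alpha> k * (\<sigma> k)\<^sup>2)"
    and meas: "\<And>k. y k \<in> borel_measurable M" "\<And>k. e k \<in> borel_measurable M"
    and nonneg: "\<And>k \<omega>. 0 \<le> y k \<omega>" "\<And>k \<omega>. 0 \<le> e k \<omega>"
    and e: "\<And>k. (\<integral>\<^sup>+ \<omega>. ennreal (e k \<omega>) \<partial>M) \<le> ennreal ((\<sigma> k)\<^sup>2)"
    and C: "0 \<le> C0" "0 \<le> C1"
    and energy: "\<And>\<omega> K. \<omega> \<in> space M \<Longrightarrow>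
      (\<Sum>k<K. \<alpha> (Suc k) * (y (Suc k) \<omega>)\<^sup>2) \<le> C0 + C1 * (\<Sum>k\<le>K. \<alpha> k * e k \<omega>)"
  shows "liminf (\<lambda>k. \<integral>\<^sup>+ \<omega>. ennreal ((y k \<omega>)\<^sup>2) \<partial>M) = 0"
    and "AE \<omega> in M. liminf (\<lambda>k. ereal (y k \<omega>)) = 0"
proof -
  note meas[measurable]
  define X where "X = (\<lambda>k \<omega>. ennreal ((y k \<omega>)\<^sup>2))"
  have X[measurable]: "X k \<in> borel_measurable M" for k unfolding X_def by measurable
  define B where "B = C0 + C1 * (\<Sum>k. \<alpha> k * (\<sigma> k)\<^sup>2)"
  have part: "(\<Sum>k<K. \<integral>\<^sup>+ \<omega>. ennreal (\<alpha> (Suc k)) * X (Suc k) \<omega> \<partial>M) \<le> ennreal B" for K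
  proof -
    have "(\<Sum>k<K. \<integral>\<^sup>+ \<omega>. ennreal (\<alpha> (Suc k)) * X (Suc k) \<omega> \<partial>M)
        = (\<integral>\<^sup>+ \<omega>. (\<Sum>k<K. ennreal (\<alpha> (Suc k)) * X (Suc k) \<omega>) \<partial>M)"
      by (subst nn_integral_sum) auto
    also have "\<dots> \<le> (\<integral>\<^sup>+ \<omega>. ennreal C0 + ennreal C1 * (\<Sum>k\<le>K. ennreal (\<alpha> k) * ennreal (e k \<omega>)) \<partial>M)"
    proof (rule nn_integral_mono)
      fix \<omega> assume "\<omega> \<in> space M"
      have "(\<Sum>k<K. ennreal (\<alpha> (Suc k)) * X (Suc k) \<omega>) = ennreal (\<Sum>k<K. \<alpha> (Suc k) * (y (Suc k) \<omega>)\<^sup>2)"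
        using \<alpha> by (simp add: X_def ennreal_mult[symmetric] sum_ennreal)
      also have "\<dots> \<le> ennreal (C0 + C1 * (\<Sum>k\<le>K. \<alpha> k * e k \<omega>))"
        by (intro ennreal_leI energy) fact
      also have "\<dots> = ennreal C0 + ennreal C1 * (\<Sum>k\<le>K. ennreal (\<alpha> k) * ennreal (e k \<omega>))"
        using \<alpha> C nonneg by (simp add: ennreal_mult sum_ennreal[symmetric] sum_nonneg)
      finally show "(\<Sum>k<K. ennreal (\<alpha> (Suc k)) * X (Suc k) \<omega>)
          \<le> ennreal C0 + ennreal C1 * (\<Sum>k\<le>K. ennreal (\<alpha> k) * ennreal (e k \<omega>))" .
    qed
    also have "\<dots> = ennreal C0 + ennreal C1 * (\<Sum>k\<le>K. ennreal (\<alpha> k) * (\<integral>\<^sup>+ \<omega>. ennreal (e k \<omega>) \<partial>M))"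
      by (simp add: nn_integral_add nn_integral_cmult nn_integral_sum emeasure_space_1)
    also have "\<dots> \<le> ennreal C0 + ennreal C1 * (\<Sum>k\<le>K. ennreal (\<alpha> k) * ennreal ((\<sigma> k)\<^sup>2))"
      by (intro add_left_mono mult_left_mono sum_mono e) auto
    also have "\<dots> = ennreal (C0 + C1 * (\<Sum>k\<le>K. \<alpha> k * (\<sigma> k)\<^sup>2))"
      using \<alpha> C by (simp add: ennreal_mult sum_ennreal[symmetric] sum_nonneg)
    also have "\<dots> \<le> ennreal B"
      unfolding B_def using \<alpha> \<alpha>\<sigma> C
      by (intro ennreal_leI add_left_mono mult_left_mono sum_le_suminf) auto
    finally show ?thesis .
  qed
  have tot: "(\<Sum>k. \<integral>\<^sup>+ \<omega>. ennreal (\<alpha> (Suc k)) * X (Suc k) \<omega> \<partial>M) \<le> ennreal B"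
    by (rule suminf_le_const[OF _ part]) simp
  then have "(\<Sum>k. ennreal (\<alpha> (Suc k)) * (\<integral>\<^sup>+ \<omega>. X (Suc k) \<omega> \<partial>M)) < \<infinity>"
    by (simp add: nn_integral_cmult le_less_trans)
  from liminf_zero_of_weighted_suminf_finite(1)[OF \<alpha> this]
  show "liminf (\<lambda>k. \<integral>\<^sup>+ \<omega>. ennreal ((y k \<omega>)\<^sup>2) \<partial>M) = 0" by (simp add: X_def)
  \<comment> \<open>The same finite total, with sum and integral exchanged, makes almost every
    pathwise series finite.\<close>
  have "(\<integral>\<^sup>+ \<omega>. (\<Sum>k. ennreal (\<alpha> (Suc k)) * X (Suc k) \<omega>) \<partial>M) \<noteq> \<infinity>"
    using tot by (subst nn_integral_suminf) (auto simp: top_unique)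
  then have "AE \<omega> in M. (\<Sum>k. ennreal (\<alpha> (Suc k)) * X (Suc k) \<omega>) \<noteq> \<infinity>"
    by (rule nn_integral_noteq_infinite[rotated]) measurable
  then show "AE \<omega> in M. liminf (\<lambda>k. ereal (y k \<omega>)) = 0"
  proof eventually_elim
    case (elim \<omega>)
    show ?case
      by (rule liminf_zero_of_weighted_suminf_finite(2)[OF \<alpha>, of "\<lambda>k. X k \<omega>"])
        (use elim nonneg in \<open>auto simp: X_def less_top\<close>)
  qed
qed

section \<open>Convergence of S4N\<close>

lemma borel_measurable_FL:
  fixes L :: "real^'n^'n"
  assumes r: "convex_efun r" "lsc_efun r" "proper_fun r" and L: "pos_def L"
    and z: "z \<in> borel_measurable M" and G: "(\<lambda>\<omega>. G \<omega> (z \<omega>)) \<in> borel_measurable M"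
  shows "(\<lambda>\<omega>. FL L r (G \<omega>) (z \<omega>)) \<in> borel_measurable M"
proof -
  note z[measurable] G[measurable]
  have [measurable]: "prox L r \<in> borel_measurable borel"
    by (rule borel_measurable_continuous_onI) (rule continuous_on_prox[OF r L])
  have [measurable]: "(\<lambda>\<omega>. matrix_inv L *v G \<omega> (z \<omega>)) \<in> borel_measurable M"
    by (rule borel_measurable_matrix_vector_mult) auto
  show ?thesis unfolding FL_def uL_def by measurable
qed

lemma borel_measurable_Gbatch:
  fixes \<G> :: "real^'n \<Rightarrow> 'xi \<Rightarrow> real^'n"
  assumes "\<And>\<xi>. \<xi> \<in> space X \<Longrightarrow> continuous_on UNIV (\<lambda>y. \<G> y \<xi>)"
    and "\<And>y. (\<lambda>\<xi>. \<G> y \<xi>) \<in> borel_measurable X"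
    and "\<And>i. i < m \<Longrightarrow> s i \<in> measurable P X" and "z \<in> borel_measurable P"
  shows "(\<lambda>\<omega>. Gbatch \<G> m s \<omega> (z \<omega>)) \<in> borel_measurable P"
  unfolding Gbatch_def
  by (intro borel_measurable_scaleR borel_measurable_const borel_measurable_sum
      borel_measurable_caratheodory[OF assms(1,2)] assms) auto

lemma edom_convex_combination:
  assumes "convex_efun r" "y \<in> edom r" "z \<in> edom r" "0 \<le> t" "t \<le> 1"
  shows "(1 - t) *\<^sub>R y + t *\<^sub>R z \<in> edom r"
proof -
  have "r ((1 - t) *\<^sub>R y + t *\<^sub>R z) \<le> ereal (1 - t) * r y + ereal t * r z"
    using assms by (simp add: convex_efun_def)
  also have "\<dots> < \<infinity>"
    using assms by (cases "r y"; cases "r z") (auto simp: edom_def)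
  finally show ?thesis by (simp add: edom_def)
qed

text \<open>For \<open>x1 = x2\<close> this compares two metrics and two gradient oracles at one point; for
  \<open>x1 = x2 - t F2\<close> it transfers the residual across a proximal step.\<close>

lemma FL_residual_comparison:
  fixes \<Lambda> :: "real^'n^'n" and r :: "real^'n \<Rightarrow> ereal"
  assumes r: "convex_efun r" "lsc_efun r" "proper_fun r" and \<Lambda>: "pos_def \<Lambda>"
    and lip: "\<And>y z. norm (g y - g z) \<le> L * norm (y - z)" and L: "0 \<le> L" and M2: "0 \<le> M2"
  obtains Q where "0 \<le> Q"
    "\<And>L2 G2 x1 x2. \<lbrakk>pos_def L2; \<And>v. norm (L2 *v v) \<le> M2 * norm v;
        norm (x1 - x2) \<le> norm (FL L2 r G2 x2)\<rbrakk>
      \<Longrightarrow> (norm (FL \<Lambda> r g x1))\<^sup>2 \<le> Q * ((norm (FL L2 r G2 x2))\<^sup>2 + (norm (g x2 - G2 x2))\<^sup>2)"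
proof -
  obtain m where m: "0 < m" "\<And>v. m * (norm v)\<^sup>2 \<le> v \<bullet> (\<Lambda> *v v)"
    by (rule pos_def_coercive[OF \<Lambda>]) (rule that)
  obtain M1 where M1: "0 \<le> M1" "\<And>v. norm (\<Lambda> *v v) \<le> M1 * norm v"
    using bounded_linear.nonneg_bounded[OF matrix_vector_mul_bounded_linear[of \<Lambda>]]
    by (auto simp: mult.commute)
  \<comment> \<open>The three coefficients \<open>1 + (M1 + M2) / m\<close>,
    \<open>1 + M1 / m\<close> and \<open>L / m\<close> of \<open>F\<close> plus \<open>1 / m\<close>
    for the gradient error. Of the second metric only the bound \<open>M2\<close> enters.\<close>
  define q where "q = 2 + (2 * M1 + M2 + L + 1) / m"
  have "(norm (FL \<Lambda> r g x1))\<^sup>2 \<le> 2 * q\<^sup>2 * ((norm (FL L2 r G2 x2))\<^sup>2 + (norm (g x2 - G2 x2))\<^sup>2)"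
    if L2: "pos_def L2" "\<And>v. norm (L2 *v v) \<le> M2 * norm v"
      and x: "norm (x1 - x2) \<le> norm (FL L2 r G2 x2)" for L2 G2 x1 x2
  proof -
    define F e where "F = norm (FL L2 r G2 x2)" and "e = norm (g x2 - G2 x2)"
    have Fe: "0 \<le> F" "0 \<le> e" by (auto simp: F_def e_def)
    have "norm (g x1 - G2 x2) \<le> norm (g x1 - g x2) + e" unfolding e_def by norm
    also have "\<dots> \<le> L * F + e"
      using lip[of x1 x2] mult_left_mono[OF x L] by (simp add: F_def)
    finally have g: "norm (g x1 - G2 x2) / m \<le> (L * F + e) / m"
      using m by (intro divide_right_mono) auto
    have "norm (FL \<Lambda> r g x1) \<le> (1 + (M1 + M2) / m) * F + (1 + M1 / m) * norm (x1 - x2) + norm (g x1 - G2 x2) / m"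
      using FL_perturbation[OF r \<Lambda> L2(1) m M1(2) L2(2)] by (simp add: F_def)
    also have "\<dots> \<le> (1 + (M1 + M2) / m) * F + (1 + M1 / m) * F + (L * F + e) / m"
      using mult_left_mono[OF x, of "1 + M1 / m"] g M1 m by (simp add: F_def)
    also have "\<dots> \<le> q * (F + e)"
    proof -
      have "0 \<le> (F + (2 * M1 + M2 + L) * e) / m + 2 * e" using Fe M1 M2 L m by auto
      then show ?thesis by (simp add: q_def add_divide_distrib algebra_simps)
    qed
    finally have "(norm (FL \<Lambda> r g x1))\<^sup>2 \<le> (q * (F + e))\<^sup>2" by (rule power_mono) simp
    also have "\<dots> = q\<^sup>2 * (F + e)\<^sup>2" by (simp add: power_mult_distrib)
    also have "\<dots> \<le> q\<^sup>2 * (2 * (F\<^sup>2 + e\<^sup>2))"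
      using sum_squares_bound[of F e] by (intro mult_left_mono) (auto simp: power2_sum)
    also have "\<dots> = 2 * q\<^sup>2 * (F\<^sup>2 + e\<^sup>2)" by simp
    finally show ?thesis by (simp only: F_def e_def)
  qed
  then show thesis by (intro that[of "2 * q\<^sup>2"]) auto
qed

theorem theorem3p6:
  fixes f :: "real^'n \<Rightarrow> real" and g :: "real^'n \<Rightarrow> real^'n"
    and r :: "real^'n \<Rightarrow> ereal"
    and P :: "'w measure" and X :: "'xi measure"
    and \<G> :: "real^'n \<Rightarrow> 'xi \<Rightarrow> real^'n" and \<H> :: "real^'n \<Rightarrow> 'xi \<Rightarrow> real^'n^'n"
    and s t :: "nat \<Rightarrow> nat \<Rightarrow> 'w \<Rightarrow> 'xi" and ng nh :: "nat \<Rightarrow> nat"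
    and \<Lambda>k :: "nat \<Rightarrow> real^'n^'n" and Mk :: "nat \<Rightarrow> 'w \<Rightarrow> real^'n^'n"
    and x :: "nat \<Rightarrow> 'w \<Rightarrow> real^'n" and \<theta> :: "nat \<Rightarrow> 'w \<Rightarrow> real"
    and x0 :: "real^'n" and \<theta>0 :: real
    and \<alpha> \<nu> \<epsilon>1 \<epsilon>2 \<sigma> :: "nat \<Rightarrow> real"
    and \<eta> p \<beta> L lam_m lam_M \<gamma> \<rho> :: real
  defines "\<psi> \<equiv> \<lambda>y. ereal (f y) + r y"
  defines "Gk \<equiv> \<lambda>k \<omega>. Gbatch \<G> (ng k) (s k) \<omega>"
  defines "Hk \<equiv> \<lambda>k \<omega>. Hbatch \<H> (nh k) (t k) \<omega>"
  (* standing assumptions *)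
  assumes grad: "\<And>y. (f has_derivative (\<lambda>h. g y \<bullet> h)) (at y)"
    and grad_cont: "continuous_on UNIV g"
    and r_convex: "convex_efun r" and r_lsc: "lsc_efun r" and r_proper: "proper_fun r"
    and P_prob: "prob_space P"
    and G_cont: "\<And>\<xi>. \<xi> \<in> space X \<Longrightarrow> continuous_on UNIV (\<lambda>y. \<G> y \<xi>)"
    and G_meas: "\<And>y. (\<lambda>\<xi>. \<G> y \<xi>) \<in> borel_measurable X"
    and H_cont: "\<And>\<xi>. \<xi> \<in> space X \<Longrightarrow> continuous_on UNIV (\<lambda>y. \<H> y \<xi>)"
    and H_meas: "\<And>y. (\<lambda>\<xi>. \<H> y \<xi>) \<in> borel_measurable X"
    and H_sym: "\<And>y \<xi>. \<xi> \<in> space X \<Longrightarrow> sym_mat (\<H> y \<xi>)"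
    and s_meas: "\<And>k i. i < ng k \<Longrightarrow> s k i \<in> measurable P X"
    and t_meas: "\<And>k j. j < nh k \<Longrightarrow> t k j \<in> measurable P X"
    and ng_pos: "\<And>k. 0 < ng k" and nh_pos: "\<And>k. 0 < nh k"
    (* algorithm parameters *)
    and x0_dom: "x0 \<in> edom r" and \<theta>0_nonneg: "0 \<le> \<theta>0"
    and \<Lambda>_pd: "\<And>k. pos_def (\<Lambda>k k)"
    and \<eta>_range: "0 < \<eta>" "\<eta> < 1" and p_range: "0 < p" "p < 1" and \<beta>_pos: "0 < \<beta>"
    and \<nu>_nonneg: "\<And>k. 0 \<le> \<nu> k" and \<epsilon>1_nonneg: "\<And>k. 0 \<le> \<epsilon>1 k"
    and \<epsilon>2_nonneg: "\<And>k. 0 \<le> \<epsilon>2 k"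
    (* the iteration of S4N *)
    and x_init: "\<And>\<omega>. \<omega> \<in> space P \<Longrightarrow> x 0 \<omega> = x0"
    and \<theta>_init: "\<And>\<omega>. \<omega> \<in> space P \<Longrightarrow> \<theta> 0 \<omega> = \<theta>0"
    and M_sel: "\<And>k \<omega>. \<omega> \<in> space P \<Longrightarrow>
                  Mk k \<omega> \<in> Mset (\<Lambda>k k) r (Gk k \<omega>) (Hk k \<omega>) (x k \<omega>)"
    and step: "\<And>k \<omega>. \<omega> \<in> space P \<Longrightarrow>
       (let Fs = FL (\<Lambda>k k) r (Gk k \<omega>) (x k \<omega>);
            d = - (pinv (Mk k \<omega>) *v Fs);
            zn = x k \<omega> + d;
            zp = x k \<omega> - \<alpha> k *\<^sub>R Fs;
            Fn = norm (FL (\<Lambda>k (Suc k)) r (Gk (Suc k) \<omega>) zn)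
        in if zn \<in> edom r
              \<and> Fn \<le> (\<eta> + \<nu> k) * \<theta> k \<omega> + \<epsilon>1 k
              \<and> \<psi> zn \<le> \<psi> (x k \<omega>) + ereal (\<beta> * \<theta> k \<omega> powr (1 - p) * Fn powr p + \<epsilon>2 k)
           then x (Suc k) \<omega> = zn \<and> \<theta> (Suc k) \<omega> = Fn
           else x (Suc k) \<omega> = zp \<and> \<theta> (Suc k) \<omega> = \<theta> k \<omega>)"
    (* (A.1), (A.2) *)
    and A1: "0 < L" "\<And>y z. norm (g y - g z) \<le> L * norm (y - z)"
    and A2: "\<exists>b. \<forall>y \<in> edom r. ereal b \<le> \<psi> y"
    (* (B.1), (B.2) *)
    and B1: "0 < lam_m" "lam_m \<le> lam_M"
            "\<And>k. loewner_le (\<Lambda>k k) (lam_M *\<^sub>R mat 1)"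
            "\<And>k. loewner_le (lam_m *\<^sub>R mat 1) (\<Lambda>k k)"
    and B2: "summable \<nu>" "summable \<epsilon>2" "summable (\<lambda>k. \<epsilon>1 k powr p)"
    (* (C.1), (C.2) *)
    and C1: "\<And>k. Mk k \<in> borel_measurable (filt P X s ng t nh k)"
    and C2: "\<And>k. 0 \<le> \<sigma> k"
            "\<And>k. (\<integral>\<^sup>+ \<omega>. ennreal ((norm (g (x k \<omega>) - Gk k \<omega> (x k \<omega>)))\<^sup>2) \<partial>P) \<le> ennreal ((\<sigma> k)\<^sup>2)"
    (* step sizes *)
    and \<alpha>_range: "\<And>k. 0 \<le> \<alpha> k" "\<And>k. \<alpha> k \<le> 1"
    and \<gamma>_range: "0 < \<gamma>" "\<gamma> < 1" and \<rho>_range: "1 < \<rho>" "\<rho> < 1 / \<gamma>"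
    and \<alpha>_descent: "\<And>k \<omega>. \<omega> \<in> space P \<Longrightarrow>
       (let v = - FL (\<Lambda>k k) r (Gk k \<omega>) (x k \<omega>)
        in \<psi> (x k \<omega> + \<alpha> k *\<^sub>R v) \<le> \<psi> (x k \<omega>) + ereal (- \<alpha> k * \<gamma> * (mnorm (\<Lambda>k k) v)\<^sup>2
              + \<alpha> k / (4 * \<gamma> * (\<rho> - 1) * lam_m) * (norm (g (x k \<omega>) - Gk k \<omega> (x k \<omega>)))\<^sup>2))"
    and \<alpha>_decr: "decseq \<alpha>"
    and \<alpha>_div: "\<not> summable \<alpha>"
    and \<alpha>\<sigma>_sum: "summable (\<lambda>k. \<alpha> k * (\<sigma> k)\<^sup>2)"
  shows "\<forall>\<Lambda>. pos_def \<Lambda> \<longrightarrow>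
           liminf (\<lambda>k. \<integral>\<^sup>+ \<omega>. ennreal ((norm (FL \<Lambda> r g (x k \<omega>)))\<^sup>2) \<partial>P) = 0
         \<and> (AE \<omega> in P. liminf (\<lambda>k. ereal (norm (FL \<Lambda> r g (x k \<omega>)))) = 0)"
proof (intro allI impI)
  fix \<Lambda> :: "real^'n^'n" assume \<Lambda>: "pos_def \<Lambda>"
  interpret P: prob_space P by (rule P_prob)
  note r = r_convex r_lsc r_proper
  define Fs where "Fs = (\<lambda>k \<omega>. FL (\<Lambda>k k) r (Gk k \<omega>) (x k \<omega>))"
  define Nw where "Nw = (\<lambda>k \<omega>. x k \<omega> - pinv (Mk k \<omega>) *v Fs k \<omega>)"
  define Fn where "Fn = (\<lambda>k \<omega>. norm (FL (\<Lambda>k (Suc k)) r (Gk (Suc k) \<omega>) (Nw k \<omega>)))"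
  define Acc where "Acc = (\<lambda>k \<omega>. r (Nw k \<omega>) < \<infinity>
      \<and> Fn k \<omega> \<le> (\<eta> + \<nu> k) * \<theta> k \<omega> + \<epsilon>1 k
      \<and> \<psi> (Nw k \<omega>) \<le> \<psi> (x k \<omega>) + ereal (\<beta> * \<theta> k \<omega> powr (1 - p) * Fn k \<omega> powr p + \<epsilon>2 k))"
  have update: "x (Suc k) \<omega> = (if Acc k \<omega> then Nw k \<omega> else x k \<omega> - \<alpha> k *\<^sub>R Fs k \<omega>)"
    "\<theta> (Suc k) \<omega> = (if Acc k \<omega> then Fn k \<omega> else \<theta> k \<omega>)" if "\<omega> \<in> space P" for k \<omega>
    using step[OF that, of k]
    by (auto simp: Let_def Acc_def Fn_def Nw_def Fs_def edom_def split: if_splits)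

  \<comment> \<open>Measurability of the iterates\<close>
  have G_meas': "(\<lambda>\<omega>. Gk k \<omega> (z \<omega>)) \<in> borel_measurable P" if "z \<in> borel_measurable P" for k z
    unfolding Gk_def using G_cont G_meas s_meas that by (rule borel_measurable_Gbatch)
  have F_meas: "(\<lambda>\<omega>. FL (\<Lambda>k j) r (Gk j \<omega>) (z \<omega>)) \<in> borel_measurable P"
    if "z \<in> borel_measurable P" for j z
    using r \<Lambda>_pd that G_meas'[OF that] by (rule borel_measurable_FL[where G = "Gk j"])
  have r_meas[measurable]: "r \<in> borel_measurable borel" by (rule borel_measurable_lsc[OF r_lsc])
  have "continuous_on UNIV f"
    using grad by (auto simp: continuous_on_eq_continuous_at intro: has_derivative_continuous)
  then have [measurable]: "f \<in> borel_measurable borel" by (rule borel_measurable_continuous_onI)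
  have \<psi>_meas[measurable]: "\<psi> \<in> borel_measurable borel" unfolding \<psi>_def by measurable
  have [measurable]: "g \<in> borel_measurable borel" using grad_cont by (rule borel_measurable_continuous_onI)
  \<comment> \<open>The acceptance test involves \<open>\<theta>\<close>, so both sequences go
    through one induction; the algorithm's equations hold on \<open>space P\<close> only, hence
    \<open>measurable_cong\<close>.\<close>
  have "x k \<in> borel_measurable P \<and> \<theta> k \<in> borel_measurable P" for k
  proof (induction k)
    case 0
    have "x 0 \<in> borel_measurable P \<longleftrightarrow> (\<lambda>_. x0) \<in> borel_measurable P" by (rule measurable_cong) (rule x_init)
    moreover have "\<theta> 0 \<in> borel_measurable P \<longleftrightarrow> (\<lambda>_. \<theta>0) \<in> borel_measurable P"
      by (rule measurable_cong) (rule \<theta>_init)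
    ultimately show ?case by simp
  next
    case (Suc k)
    then have [measurable]: "x k \<in> borel_measurable P" "\<theta> k \<in> borel_measurable P" by auto
    have [measurable]: "Fs k \<in> borel_measurable P" unfolding Fs_def by (rule F_meas) measurable
    have "Mk k \<in> borel_measurable P" using s_meas t_meas C1 by (rule borel_measurable_filt)
    then have "(\<lambda>\<omega>. pinv (Mk k \<omega>)) \<in> borel_measurable P" by (rule measurable_compose[OF _ borel_measurable_pinv])
    then have "(\<lambda>\<omega>. pinv (Mk k \<omega>) *v Fs k \<omega>) \<in> borel_measurable P"
      by (rule borel_measurable_matrix_vector_mult) measurable
    then have Nw[measurable]: "Nw k \<in> borel_measurable P" unfolding Nw_def by measurable
    note F_meas[OF Nw, of "Suc k", measurable]
    have [measurable]: "Fn k \<in> borel_measurable P" unfolding Fn_def by measurable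
    have [measurable]: "Measurable.pred P (Acc k)" unfolding Acc_def by measurable
    have "x (Suc k) \<in> borel_measurable P \<longleftrightarrow>
        (\<lambda>\<omega>. if Acc k \<omega> then Nw k \<omega> else x k \<omega> - \<alpha> k *\<^sub>R Fs k \<omega>) \<in> borel_measurable P"
      by (rule measurable_cong) (rule update)
    moreover have "\<theta> (Suc k) \<in> borel_measurable P \<longleftrightarrow>
        (\<lambda>\<omega>. if Acc k \<omega> then Fn k \<omega> else \<theta> k \<omega>) \<in> borel_measurable P"
      by (rule measurable_cong) (rule update)
    ultimately show ?case by simp
  qed
  then have x_meas[measurable]: "x k \<in> borel_measurable P" for k by blast

  \<comment> \<open>Feasibility of the iterates and finite objective values\<close>
  have x_dom: "x k \<omega> \<in> edom r" if \<omega>: "\<omega> \<in> space P" for k \<omega>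
  proof (induction k)
    case (Suc k)
    define y where "y = prox (\<Lambda>k k) r (uL (\<Lambda>k k) (Gk k \<omega>) (x k \<omega>))"
    have "y \<in> edom r" unfolding y_def by (rule prox_variational_inequality(1)[OF r \<Lambda>_pd])
    then have "(1 - \<alpha> k) *\<^sub>R x k \<omega> + \<alpha> k *\<^sub>R y \<in> edom r"
      using Suc \<alpha>_range by (intro edom_convex_combination r_convex) auto
    \<comment> \<open>As \<open>\<alpha> k\<close> lies in the unit interval, the proximal step is a
      convex combination of two feasible points; Newton points are tested for feasibility.\<close>
    moreover have "x k \<omega> - \<alpha> k *\<^sub>R Fs k \<omega> = (1 - \<alpha> k) *\<^sub>R x k \<omega> + \<alpha> k *\<^sub>R y"
      by (simp add: Fs_def FL_def y_def algebra_simps)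
    ultimately show ?case using update(1)[OF \<omega>, of k] by (auto simp: Acc_def edom_def)
  qed (use that x_init x0_dom in simp)
  define \<phi> where "\<phi> = (\<lambda>y. real_of_ereal (\<psi> y))"
  have \<psi>_fin: "\<psi> y = ereal (\<phi> y)" if "y \<in> edom r" for y
    using that r_proper by (cases "r y") (auto simp: \<phi>_def \<psi>_def edom_def proper_fun_def)
  obtain b where b: "\<And>y. y \<in> edom r \<Longrightarrow> ereal b \<le> \<psi> y" using A2 by blast
  have \<theta>_nonneg: "0 \<le> \<theta> k \<omega>" if "\<omega> \<in> space P" for k \<omega>
    by (induction k) (use that \<theta>_init \<theta>0_nonneg update(2)[OF that] in \<open>auto simp: Fn_def\<close>)

  \<comment> \<open>The two alternatives of a step\<close>
  have "0 \<le> L" "0 \<le> lam_M" using A1(1) B1(1,2) by auto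
  \<comment> \<open>\<open>Q\<close> is uniform over all metrics bounded by \<open>lam_M\<close>, so
    one constant serves every iteration.\<close>
  then obtain Q where Q: "0 \<le> Q"
    "\<And>L2 G2 x1 x2. \<lbrakk>pos_def L2; \<And>v. norm (L2 *v v) \<le> lam_M * norm v;
        norm (x1 - x2) \<le> norm (FL L2 r G2 x2)\<rbrakk>
      \<Longrightarrow> (norm (FL \<Lambda> r g x1))\<^sup>2 \<le> Q * ((norm (FL L2 r G2 x2))\<^sup>2 + (norm (g x2 - G2 x2))\<^sup>2)"
    using FL_residual_comparison[OF r \<Lambda> A1(2)] by metis
  have \<Lambda>k_bound: "norm (\<Lambda>k k *v v) \<le> lam_M * norm v" for k v
    by (rule pos_def_norm_bound[OF \<Lambda>_pd B1(3)])
  have \<Lambda>k_lower: "lam_m * (norm v)\<^sup>2 \<le> (mnorm (\<Lambda>k k) v)\<^sup>2" for k v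
    using B1(4)[of k] unfolding mnorm_power2[OF \<Lambda>_pd]
    by (simp add: loewner_le_def scaleR_matrix_vector_assoc[symmetric] power2_norm_eq_inner)
  define c where "c = 1 / (4 * \<gamma> * (\<rho> - 1) * lam_m)"
  have c: "0 \<le> c" using \<gamma>_range \<rho>_range B1 by (simp add: c_def)
  define e where "e = (\<lambda>k \<omega>. (norm (g (x k \<omega>) - Gk k \<omega> (x k \<omega>)))\<^sup>2)"
  have e_nonneg: "0 \<le> e k \<omega>" for k \<omega> by (simp add: e_def)
  define W where "W = (\<lambda>k \<omega>. (norm (FL \<Lambda> r g (x k \<omega>)))\<^sup>2)"
  have alternative: "\<theta> (Suc k) \<omega> = \<theta> k \<omega>
             \<and> \<phi> (x (Suc k) \<omega>) \<le> \<phi> (x k \<omega>) - \<alpha> k * (\<gamma> * lam_m) * (norm (Fs k \<omega>))\<^sup>2 + \<alpha> k * c * e k \<omega>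
             \<and> W (Suc k) \<omega> \<le> Q * ((norm (Fs k \<omega>))\<^sup>2 + e k \<omega>)
         \<or> \<theta> (Suc k) \<omega> \<le> (\<eta> + \<nu> k) * \<theta> k \<omega> + \<epsilon>1 k
             \<and> \<phi> (x (Suc k) \<omega>) \<le> \<phi> (x k \<omega>) + (\<beta> * \<theta> k \<omega> powr (1 - p) * \<theta> (Suc k) \<omega> powr p + \<epsilon>2 k)
             \<and> W (Suc k) \<omega> \<le> Q * ((\<theta> (Suc k) \<omega>)\<^sup>2 + e (Suc k) \<omega>)"
    if \<omega>: "\<omega> \<in> space P" for k \<omega>
  proof (cases "Acc k \<omega>")
    case True
    then have x': "x (Suc k) \<omega> = Nw k \<omega>" and \<theta>': "\<theta> (Suc k) \<omega> = Fn k \<omega>" using update[OF \<omega>, of k] by auto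
    have "\<phi> (x (Suc k) \<omega>) \<le> \<phi> (x k \<omega>) + (\<beta> * \<theta> k \<omega> powr (1 - p) * \<theta> (Suc k) \<omega> powr p + \<epsilon>2 k)"
      using True \<psi>_fin[OF x_dom[OF \<omega>]] unfolding Acc_def x'[symmetric] \<theta>'[symmetric] by simp
    \<comment> \<open>After acceptance \<open>\<theta>\<close> is the norm of the stochastic
      residual at the new point itself, with the next metric and batch; the comparison is at one
      point and the error has index \<open>Suc k\<close>.\<close>
    moreover have "W (Suc k) \<omega> \<le> Q * ((\<theta> (Suc k) \<omega>)\<^sup>2 + e (Suc k) \<omega>)"
      unfolding W_def e_def \<theta>' Fn_def x'[symmetric] by (rule Q(2)[OF \<Lambda>_pd \<Lambda>k_bound]) simp
    ultimately show ?thesis using True by (simp add: Acc_def \<theta>')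
  next
    case False
    then have x': "x (Suc k) \<omega> = x k \<omega> - \<alpha> k *\<^sub>R Fs k \<omega>" and \<theta>': "\<theta> (Suc k) \<omega> = \<theta> k \<omega>"
      using update[OF \<omega>, of k] by auto
    have "\<psi> (x (Suc k) \<omega>) \<le> \<psi> (x k \<omega>) + ereal (- \<alpha> k * \<gamma> * (mnorm (\<Lambda>k k) (- Fs k \<omega>))\<^sup>2 + \<alpha> k * c * e k \<omega>)"
      using \<alpha>_descent[OF \<omega>, of k] by (simp add: Let_def x' Fs_def e_def c_def)
    then have "\<phi> (x (Suc k) \<omega>) \<le> \<phi> (x k \<omega>) - \<alpha> k * \<gamma> * (mnorm (\<Lambda>k k) (- Fs k \<omega>))\<^sup>2 + \<alpha> k * c * e k \<omega>"
      using \<psi>_fin[OF x_dom[OF \<omega>]] by simp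
    moreover have "\<alpha> k * \<gamma> * (lam_m * (norm (- Fs k \<omega>))\<^sup>2) \<le> \<alpha> k * \<gamma> * (mnorm (\<Lambda>k k) (- Fs k \<omega>))\<^sup>2"
      using \<alpha>_range \<gamma>_range by (intro mult_left_mono \<Lambda>k_lower) auto
    ultimately have "\<phi> (x (Suc k) \<omega>) \<le> \<phi> (x k \<omega>) - \<alpha> k * (\<gamma> * lam_m) * (norm (Fs k \<omega>))\<^sup>2 + \<alpha> k * c * e k \<omega>"
      by (simp add: mult.assoc)
    \<comment> \<open>Here the residual and the gradient error belong to the old point, and the step
      is no longer than that residual.\<close>
    moreover have "W (Suc k) \<omega> \<le> Q * ((norm (Fs k \<omega>))\<^sup>2 + e k \<omega>)"
      unfolding W_def e_def Fs_def
    proof (rule Q(2)[OF \<Lambda>_pd \<Lambda>k_bound])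
      show "norm (x (Suc k) \<omega> - x k \<omega>) \<le> norm (FL (\<Lambda>k k) r (Gk k \<omega>) (x k \<omega>))"
        using \<alpha>_range by (simp add: x' Fs_def mult_left_le_one_le)
    qed
    ultimately show ?thesis using \<theta>' by simp
  qed

  \<comment> \<open>From the pathwise energy bound to the two lower limits\<close>
  have \<epsilon>1: "summable \<epsilon>1" by (rule summable_of_powr_summable[OF \<epsilon>1_nonneg p_range B2(3)])
  have "0 < \<gamma> * lam_m" using \<gamma>_range B1 by simp
  \<comment> \<open>The constants are the same for all \<open>\<omega>\<close> because
    \<open>x0\<close> and \<open>\<theta>0\<close> are deterministic; the bound can therefore be
    integrated.\<close>
  obtain C0 C1 where C: "0 \<le> C0" "0 \<le> C1" and bound: "\<And>\<omega> K. \<omega> \<in> space P \<Longrightarrow>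
      (\<Sum>k<K. \<alpha> (Suc k) * W (Suc k) \<omega>) \<le> C0 + C1 * (\<Sum>k\<le>K. \<alpha> k * e k \<omega>)"
  proof (rule path_energy_bound[where \<phi> = "\<lambda>k \<omega>. \<phi> (x k \<omega>)" and \<theta> = \<theta> and W = W and e = e
        and v = "\<lambda>k \<omega>. norm (Fs k \<omega>)" and \<Omega> = "space P" and \<theta>init = \<theta>0 and b = b,
        OF \<alpha>_range \<alpha>_decr \<nu>_nonneg B2(1) \<epsilon>1_nonneg \<epsilon>1 \<epsilon>2_nonneg B2(2)
          \<eta>_range p_range \<beta>_pos \<theta>0_nonneg Q(1) c \<open>0 < \<gamma> * lam_m\<close>])
    show "b \<le> \<phi> (x k \<omega>)" if "\<omega> \<in> space P" for k \<omega>
      using b[OF x_dom[OF that]] \<psi>_fin[OF x_dom[OF that]] by simp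
    show "\<phi> (x 0 \<omega>) = \<phi> x0" if "\<omega> \<in> space P" for \<omega> by (simp add: x_init[OF that])
  qed (use that alternative \<theta>_init \<theta>_nonneg e_nonneg in \<open>simp_all add: W_def\<close>)
  have meas: "(\<lambda>\<omega>. norm (FL \<Lambda> r g (x k \<omega>))) \<in> borel_measurable P" "e k \<in> borel_measurable P" for k
  proof -
    have "(\<lambda>\<omega>. g (x k \<omega>)) \<in> borel_measurable P" by measurable
    from borel_measurable_FL[where G = "\<lambda>_. g", OF r \<Lambda> x_meas this]
    show "(\<lambda>\<omega>. norm (FL \<Lambda> r g (x k \<omega>))) \<in> borel_measurable P" by measurable
    note G_meas'[OF x_meas, measurable]
    show "e k \<in> borel_measurable P" unfolding e_def by measurable
  qed
  have "(\<integral>\<^sup>+ \<omega>. ennreal (e k \<omega>) \<partial>P) \<le> ennreal ((\<sigma> k)\<^sup>2)" for k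
    unfolding e_def by (rule C2(2))
  note lims = P.liminf_of_expected_energy_bound[OF \<alpha>_range(1) \<alpha>_div \<alpha>\<sigma>_sum meas norm_ge_zero e_nonneg this C bound[unfolded W_def]]
  show "liminf (\<lambda>k. \<integral>\<^sup>+ \<omega>. ennreal ((norm (FL \<Lambda> r g (x k \<omega>)))\<^sup>2) \<partial>P) = 0
      \<and> (AE \<omega> in P. liminf (\<lambda>k. ereal (norm (FL \<Lambda> r g (x k \<omega>)))) = 0)"
    using lims by blast
qed

end
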